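(* Let $A$ be a finite set and $\mathbf{B}=(B,\mathcal{F})$ a finite idempotent algebra with $|A|,|B|>1$. Then the set $\mathcal{C}_{A,\mathbf{B}}$ of all clonoids with source set $A$ and target algebra $\mathbf{B}$ has the cardinality of the continuum if and only if $\mathbf{B}$ has no cube term.
   Context: $\mathbb{N}=\{1,2,\dots\}$ and $[k]=\{1,\dots,k\}$. An algebra $\mathbf{B}=(B,\mathcal{F})$ is a set $B$ with a (possibly empty, possibly infinite) set $\mathcal{F}$ of finitary operations on $B$; it is finite if $B$ is finite, and idempotent if $f(x,\dots,x)=x$ for every $f\in\mathcal{F}$ and $x\in B$. Its term operations are the operations obtained from projections and $\mathcal{F}$ by composition. Minors: for $f\colon A^k\to B$, $\ell\in\mathbb{N}$ and $\sigma\colon[k]\to[\ell]$, the function $f^\sigma\colon A^\ell\to B$, $(x_1,\dots,x_\ell)\mapsto f(x_{\sigma(1)},\dots,x_{\sigma(k)})$ is a minor of $f$. Clonoids: for $C\subseteq\bigcup_{n\in\mathbb{N}}B^{A^n}$ let $C_k:=C\cap B^{A^k}$. $C$ is a clonoid with source set $A$ and target algebra $\mathbf{B}$ if $C$ is closed under taking minors and, for all $k\in\mathbb{N}$, $C_k$ is a subalgebra of $\mathbf{B}^{A^k}$ (i.e. closed under the pointwise operations of $\mathbf{B}$; the empty set is allowed). Cube terms: for $k\in\mathbb{N}$ let $X$ be the $k\times(2^k-1)$ matrix whose columns are the elements of $\{x,y\}^k\setminus\{\bar x\}$ (formal tuples in two variables $x,y$), where $\bar x=(x,\dots,x)$. A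 $k$-cube term of $\mathbf{B}$ is a $(2^k-1)$-ary term operation $c$ of $\mathbf{B}$ such that $c(X)=\bar x$ for all $x,y\in B$, where $c$ is applied to every row of $X$. A cube term is a $k$-cube term for some $k$. *)

theory Defs
  imports Complex_Main "HOL-Library.FuncSet" "HOL-Library.Equipollence"
begin

text \<open>
  Tuples in \<open>A\<^sup>k\<close> are extensional functions on \<open>{1..k}\<close>, and functions \<open>A\<^sup>k \<rightarrow> B\<close> are
  extensional functions on these tuples.  In sets mixing several arities, a function is stored
  together with its arity: the extensional function alone need not determine it (consider the
  constant function with value \<^term>\<open>undefined\<close>).
\<close>

definition tuples :: "'a set \<Rightarrow> nat \<Rightarrow> (nat \<Rightarrow> 'a) set" where
  "tuples A k = {1..k} \<rightarrow>\<^sub>E A"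

type_synonym ('a, 'b) finitary = "nat \<times> ((nat \<Rightarrow> 'a) \<Rightarrow> 'b)"

definition algebra :: "'b set \<Rightarrow> ('b, 'b) finitary set \<Rightarrow> bool" where
  "algebra B F \<longleftrightarrow> (\<forall>(n, f) \<in> F. f \<in> tuples B n \<rightarrow>\<^sub>E B)"

definition idempotent :: "'b set \<Rightarrow> ('b, 'b) finitary set \<Rightarrow> bool" where
  "idempotent B F \<longleftrightarrow> (\<forall>(n, f) \<in> F. \<forall>x \<in> B. f (\<lambda>i\<in>{1..n}. x) = x)"

text \<open>
  Pointwise application of an \<open>n\<close>-ary \<open>f\<close> to functions \<open>g 1, \<dots>, g n\<close> with common domain \<open>X\<close>;
  for \<open>X = B\<^sup>k\<close> this is composition of operations, for \<open>X = A\<^sup>k\<close> it is the operation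
  induced by \<open>f\<close> on the power \<open>B\<close> to the \<open>A\<^sup>k\<close>.
\<close>
definition pointwise ::
    "'x set \<Rightarrow> nat \<Rightarrow> ((nat \<Rightarrow> 'b) \<Rightarrow> 'b) \<Rightarrow> (nat \<Rightarrow> 'x \<Rightarrow> 'b) \<Rightarrow> ('x \<Rightarrow> 'b)" where
  "pointwise X n f g = (\<lambda>x\<in>X. f (\<lambda>i\<in>{1..n}. g i x))"

inductive_set term_operations ::
    "'b set \<Rightarrow> ('b, 'b) finitary set \<Rightarrow> ('b, 'b) finitary set"
  for B :: "'b set" and F :: "('b, 'b) finitary set" where
  projection: "i \<in> {1..k} \<Longrightarrow> (k, \<lambda>x\<in>tuples B k. x i) \<in> term_operations B F"
| basic: "(n, f) \<in> F \<Longrightarrow> (n, f) \<in> term_operations B F"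
| composition: "(n, f) \<in> term_operations B F \<Longrightarrow>
    (\<forall>i\<in>{1..n}. (k, g i) \<in> term_operations B F) \<Longrightarrow>
    (k, pointwise (tuples B k) n f g) \<in> term_operations B F"

definition subalgebra_of_power ::
    "'x set \<Rightarrow> 'b set \<Rightarrow> ('b, 'b) finitary set \<Rightarrow> ('x \<Rightarrow> 'b) set \<Rightarrow> bool" where
  "subalgebra_of_power X B F S \<longleftrightarrow>
     S \<subseteq> X \<rightarrow>\<^sub>E B \<and> (\<forall>(n, f) \<in> F. \<forall>g \<in> {1..n} \<rightarrow> S. pointwise X n f g \<in> S)"

definition minor ::
    "'a set \<Rightarrow> nat \<Rightarrow> nat \<Rightarrow> ((nat \<Rightarrow> 'a) \<Rightarrow> 'b) \<Rightarrow> (nat \<Rightarrow> nat) \<Rightarrow> ((nat \<Rightarrow> 'a) \<Rightarrow> 'b)" where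
  "minor A k l f \<sigma> = (\<lambda>x\<in>tuples A l. f (\<lambda>i\<in>{1..k}. x (\<sigma> i)))"

definition clonoid ::
    "'a set \<Rightarrow> 'b set \<Rightarrow> ('b, 'b) finitary set \<Rightarrow> ('a, 'b) finitary set \<Rightarrow> bool" where
  "clonoid A B F C \<longleftrightarrow>
     C \<subseteq> {(n, f). 1 \<le> n \<and> f \<in> tuples A n \<rightarrow>\<^sub>E B} \<and>
     (\<forall>(k, f) \<in> C. \<forall>l\<ge>1. \<forall>\<sigma> \<in> {1..k} \<rightarrow> {1..l}. (l, minor A k l f \<sigma>) \<in> C) \<and>
     (\<forall>k\<ge>1. subalgebra_of_power (tuples A k) B F {f. (k, f) \<in> C})"

definition clonoids ::
    "'a set \<Rightarrow> 'b set \<Rightarrow> ('b, 'b) finitary set \<Rightarrow> ('a, 'b) finitary set set" where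
  "clonoids A B F = {C. clonoid A B F C}"

datatype formal_var = Var_x | Var_y

primrec assign :: "'b \<Rightarrow> 'b \<Rightarrow> formal_var \<Rightarrow> 'b" where
  "assign x y Var_x = x"
| "assign x y Var_y = y"

text \<open>
  \<open>M i j\<close> is the entry in row \<open>i\<close> and column \<open>j\<close>.  The columns may be listed in any order;
  as term operations are closed under permuting arguments, the order does not affect the
  existence of a cube term.
\<close>
definition cube_matrix :: "nat \<Rightarrow> (nat \<Rightarrow> nat \<Rightarrow> formal_var) \<Rightarrow> bool" where
  "cube_matrix k M \<longleftrightarrow>
     bij_betw (\<lambda>j. \<lambda>i\<in>{1..k}. M i j) {1..2 ^ k - 1}
       (tuples {Var_x, Var_y} k - {\<lambda>i\<in>{1..k}. Var_x})"

definition cube_term ::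
    "'b set \<Rightarrow> ('b, 'b) finitary set \<Rightarrow> nat \<Rightarrow> ((nat \<Rightarrow> 'b) \<Rightarrow> 'b) \<Rightarrow> bool" where
  "cube_term B F k c \<longleftrightarrow>
     (2 ^ k - 1, c) \<in> term_operations B F \<and>
     (\<exists>M. cube_matrix k M \<and>
        (\<forall>x\<in>B. \<forall>y\<in>B. \<forall>i\<in>{1..k}. c (\<lambda>j\<in>{1..2 ^ k - 1}. assign x y (M i j)) = x))"

definition has_cube_term :: "'b set \<Rightarrow> ('b, 'b) finitary set \<Rightarrow> bool" where
  "has_cube_term B F \<longleftrightarrow> (\<exists>k\<ge>1. \<exists>c. cube_term B F k c)"

end

theory Submission
  imports Defs "HOL-Analysis.Abstract_Topology_2" "HOL-Library.Infinite_Set" "HOL-Library.Sublist"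
begin

text \<open>
  Without a cube term: cube terms that work for single pairs \<open>(c, d)\<close> can be composed, over all pairs
  of the finite idempotent algebra, to a cube term.  So for some \<open>c, d \<in> B\<close> and every \<open>n\<close> the
  subalgebra \<open>T\<^sub>n\<close> of \<open>B\<^sup>n\<close> generated by \<open>{c, d}\<^sup>n - {(c, \<dots>, c)}\<close> omits \<open>(c, \<dots>, c)\<close>.  Let \<open>P\<^sub>n\<close>
  consist of the \<open>n\<close> unit vectors over two elements of \<open>A\<close>, and let the \<open>m\<close>-ary \<open>f\<^sub>m\<close> be \<open>c\<close> on the unit
  vectors and \<open>d\<close> elsewhere.  Then \<open>f\<^sub>m\<close> maps \<open>P\<^sub>n\<close> into \<open>T\<^sub>n\<close> if and only if \<open>m \<noteq> n\<close>, which yields a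
  clonoid for every set of natural numbers.

  With a cube term: by repeated substitution into itself a cube term becomes an edge term, and hence
  subalgebras \<open>R \<subseteq> S\<close> of \<open>B\<^sup>X\<close> are equal as soon as they have the same forks with respect to a linear
  order of \<open>X\<close> and the same projections to boundedly many coordinates.  Let \<open>C\<^sup>n\<close> consist of the
  functions all of whose minors of arity at most \<open>n\<close> are in \<open>C\<close>.  For the lexicographic orders of the
  \<open>A\<^sup>k\<close> the forks of a set closed under minors form a down-set in a well-quasi-order (Higman's lemma), so
  the forks of the decreasing sequence \<open>C\<^sup>n\<close> stabilise, and therefore \<open>C = C\<^sup>n\<close> for some \<open>n\<close>.  Thus \<open>C\<close> is
  determined by \<open>n\<close> and finitely many of its members.
\<close>

subsection \<open>Terms over an index set\<close>

text \<open>Terms are functions of an assignment on an arbitrary index set, so that variables can be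
  sets of rows or the generators of a subalgebra. Assignments are total, but only their values on
  \<open>J\<close> matter (\<open>term_over_cong\<close>).\<close>

inductive term_over :: "('b, 'b) finitary set \<Rightarrow> 'i set \<Rightarrow> (('i \<Rightarrow> 'b) \<Rightarrow> 'b) \<Rightarrow> bool"
  for F :: "('b, 'b) finitary set" and J :: "'i set" where
  term_over_proj: "j \<in> J \<Longrightarrow> term_over F J (\<lambda>g. g j)"
| term_over_op: "(n, f) \<in> F \<Longrightarrow> \<forall>i\<in>{1..n}. term_over F J (t i) \<Longrightarrow>
    term_over F J (\<lambda>g. f (\<lambda>i\<in>{1..n}. t i g))"

lemma term_over_subst:
  assumes "term_over F J t" and "\<And>j. j \<in> J \<Longrightarrow> term_over F J' (s j)"
  shows "term_over F J' (\<lambda>g. t (\<lambda>j. s j g))"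
  using assms(1)
proof induction
  case (term_over_proj j)
  then show ?case using assms(2) by simp
next
  case (term_over_op n f t)
  have "term_over F J' (\<lambda>g. f (\<lambda>i\<in>{1..n}. (\<lambda>g. t i (\<lambda>j. s j g)) g))"
    by (rule term_over.term_over_op) (use term_over_op in auto)
  then show ?case by simp
qed

lemma term_over_rename:
  assumes "term_over F J t" and "\<And>j. j \<in> J \<Longrightarrow> h j \<in> J'"
  shows "term_over F J' (\<lambda>g. t (\<lambda>j. g (h j)))"
  using term_over_subst[OF assms(1), where s = "\<lambda>j g. g (h j)"] assms(2) by (auto intro: term_over_proj)

lemma term_over_mono: "term_over F J t \<Longrightarrow> J \<subseteq> J' \<Longrightarrow> term_over F J' t"
  using term_over_rename[of F J t id J'] by auto

lemma term_over_cong: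
  assumes "term_over F J t" and "\<And>j. j \<in> J \<Longrightarrow> g j = g' j"
  shows "t g = t g'"
  using assms(1)
proof induction
  case (term_over_op n f t)
  then have "(\<lambda>i\<in>{1..n}. t i g) = (\<lambda>i\<in>{1..n}. t i g')" by auto
  then show ?case by simp
qed (use assms(2) in simp)

lemma term_over_closed:
  assumes "algebra B F" and "term_over F J t" and "\<And>j. j \<in> J \<Longrightarrow> g j \<in> B"
  shows "t g \<in> B"
  using assms(2)
proof induction
  case (term_over_op n f t)
  have "f \<in> tuples B n \<rightarrow>\<^sub>E B" using assms(1) term_over_op by (auto simp: algebra_def)
  moreover have "(\<lambda>i\<in>{1..n}. t i g) \<in> tuples B n" using term_over_op by (auto simp: tuples_def)
  ultimately show ?case by auto
qed (use assms(3) in simp)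

lemma term_over_idem:
  assumes "idempotent B F" and "term_over F J t" and "b \<in> B"
  shows "t (\<lambda>_. b) = b"
  using assms(2)
proof induction
  case (term_over_op n f t)
  have "(\<lambda>i\<in>{1..n}. t i (\<lambda>_. b)) = (\<lambda>i\<in>{1..n}. b)" using term_over_op by auto
  then show ?case using assms(1,3) term_over_op by (auto simp: idempotent_def)
qed simp

lemma term_over_const:
  assumes "idempotent B F" and "term_over F J t" and "b \<in> B" and "\<And>j. j \<in> J \<Longrightarrow> g j = b"
  shows "t g = b"
  using term_over_cong[OF assms(2), of g "\<lambda>_. b"] term_over_idem[OF assms(1-3)] assms(4) by simp

lemma term_over_subpower:
  assumes "subalgebra_of_power X B F R" and "term_over F J t" and "\<And>j. j \<in> J \<Longrightarrow> g j \<in> R"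
  shows "(\<lambda>x\<in>X. t (\<lambda>j. g j x)) \<in> R"
  using assms(2)
proof induction
  case (term_over_proj j)
  then have "g j \<in> X \<rightarrow>\<^sub>E B" using assms by (auto simp: subalgebra_of_power_def)
  then have "(\<lambda>x\<in>X. g j x) = g j" by (rule PiE_restrict)
  then show ?case using term_over_proj assms(3) by simp
next
  case (term_over_op n f t)
  have "pointwise X n f (\<lambda>i. \<lambda>x\<in>X. t i (\<lambda>j. g j x)) \<in> R"
    using assms(1) term_over_op unfolding subalgebra_of_power_def by blast
  moreover have "pointwise X n f (\<lambda>i. \<lambda>x\<in>X. t i (\<lambda>j. g j x))
      = (\<lambda>x\<in>X. f (\<lambda>i\<in>{1..n}. t i (\<lambda>j. g j x)))"
    unfolding pointwise_def by (intro restrict_ext) (auto intro!: arg_cong[where f = f])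
  ultimately show ?case by (simp only:)
qed

lemma term_over_imp_term_operation:
  assumes "term_over F {1..k} t"
  shows "(k, \<lambda>x\<in>tuples B k. t x) \<in> term_operations B F"
  using assms
proof induction
  case (term_over_proj j)
  then show ?case by (rule term_operations.projection)
next
  case (term_over_op n f t)
  have "(k, pointwise (tuples B k) n f (\<lambda>i. \<lambda>x\<in>tuples B k. t i x)) \<in> term_operations B F"
    by (rule term_operations.composition[OF term_operations.basic]) (use term_over_op in blast)+
  moreover have "pointwise (tuples B k) n f (\<lambda>i. \<lambda>x\<in>tuples B k. t i x)
      = (\<lambda>x\<in>tuples B k. f (\<lambda>i\<in>{1..n}. t i x))"
    unfolding pointwise_def by (intro restrict_ext) (auto intro!: arg_cong[where f = f])
  ultimately show ?case by (simp only:)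
qed

text \<open>Agreement is claimed on tuples over \<open>B\<close> only, so in a composition the inner
  values must lie in \<open>B\<close> before the equation for the outer operation applies.\<close>

lemma term_operation_imp_term_over:
  assumes "algebra B F" and "(k, c) \<in> term_operations B F"
  shows "\<exists>t. term_over F {1..k} t \<and> (\<forall>x\<in>tuples B k. c x = t x)"
  using assms(2)
proof induction
  case (projection i k)
  then show ?case by (intro exI[of _ "\<lambda>x. x i"]) (auto intro: term_over_proj)
next
  case (basic n f)
  have "term_over F {1..n} (\<lambda>g. f (\<lambda>i\<in>{1..n}. (\<lambda>g. g i) g))"
    by (rule term_over_op) (use basic in \<open>auto intro: term_over_proj\<close>)
  moreover have "(\<lambda>i\<in>{1..n}. x i) = x" if "x \<in> tuples B n" for x
    using PiE_restrict[of x] that unfolding tuples_def by simp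
  ultimately show ?case by (intro exI[of _ "\<lambda>g. f (\<lambda>i\<in>{1..n}. g i)"]) simp
next
  case (composition n f k g)
  then obtain t where t: "term_over F {1..n} t" "\<forall>x\<in>tuples B n. f x = t x" by blast
  have "\<forall>i\<in>{1..n}. \<exists>s. term_over F {1..k} s \<and> (\<forall>x\<in>tuples B k. g i x = s x)"
    using composition by blast
  then obtain s where s: "\<forall>i\<in>{1..n}. term_over F {1..k} (s i) \<and> (\<forall>x\<in>tuples B k. g i x = s i x)"
    by metis
  have "term_over F {1..k} (\<lambda>g. t (\<lambda>j. s j g))" using term_over_subst[OF t(1), of "{1..k}" s] s by simp
  moreover have "pointwise (tuples B k) n f g x = t (\<lambda>j. s j x)" if x: "x \<in> tuples B k" for x
  proof -
    have "s i x \<in> B" if "i \<in> {1..n}" for i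
      using term_over_closed[OF assms(1), of "{1..k}" "s i" x] s that PiE_mem[OF x[unfolded tuples_def]]
      by simp
    then have "(\<lambda>i\<in>{1..n}. g i x) \<in> tuples B n" using s x by (simp add: tuples_def)
    then have "pointwise (tuples B k) n f g x = t (\<lambda>i\<in>{1..n}. g i x)"
      using t(2) x by (simp add: pointwise_def)
    also have "\<dots> = t (\<lambda>j. s j x)"
      using term_over_cong[OF t(1), of "\<lambda>i\<in>{1..n}. g i x" "\<lambda>j. s j x"] s x by simp
    finally show ?thesis .
  qed
  ultimately show ?case by blast
qed

subsection \<open>Composing cube terms\<close>

text \<open>A column of a cube matrix is encoded by the non-empty set \<open>U\<close> of the rows
  containing \<open>y\<close>, which avoids enumerating the columns. \<open>W\<close> collects the
  pairs for which the cube identities already hold.\<close>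

definition cube_op ::
    "'b set \<Rightarrow> ('b, 'b) finitary set \<Rightarrow> nat set \<Rightarrow> ('b \<times> 'b) set \<Rightarrow> ((nat set \<Rightarrow> 'b) \<Rightarrow> 'b) \<Rightarrow> bool" where
  "cube_op B F I W t \<longleftrightarrow> term_over F (Pow I - {{}}) t \<and>
     (\<forall>(x, y)\<in>W. \<forall>i\<in>I. t (\<lambda>U. if i \<in> U then y else x) = x)"

lemma term_over_image:
  assumes "term_over F (h ` I) t"
  shows "term_over F I (\<lambda>g. t (\<lambda>j. g (inv_into I h j)))"
proof (rule term_over_rename[OF assms])
  show "inv_into I h j \<in> I" if "j \<in> h ` I" for j
    using that by (rule inv_into_into)
qed

lemma cube_op_reindex:
  assumes t: "cube_op B F I W t" and h: "bij_betw h I I'"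
  shows "\<exists>t'. cube_op B F I' W t'"
proof
  let ?t = "\<lambda>g. t (\<lambda>U. g (h ` U))"
  have hI: "h ` I = I'" and inj: "inj_on h I" using h by (auto simp: bij_betw_def)
  have tm: "term_over F (Pow I - {{}}) t" using t by (simp add: cube_op_def)
  have "term_over F (Pow I' - {{}}) ?t" by (rule term_over_rename[OF tm]) (use hI in auto)
  moreover have "?t (\<lambda>U. if i' \<in> U then y else x) = x" if xy: "(x, y) \<in> W" "i' \<in> I'" for x y i'
  proof -
    obtain i where i: "i \<in> I" "i' = h i" using xy(2) unfolding hI[symmetric] by blast
    have "?t (\<lambda>U. if i' \<in> U then y else x) = t (\<lambda>U. if i \<in> U then y else x)"
    proof (rule term_over_cong[OF tm])
      fix U assume "U \<in> Pow I - {{}}"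
      then have "i' \<in> h ` U \<longleftrightarrow> i \<in> U" using i inj by (auto simp: inj_on_def)
      then show "(if i' \<in> h ` U then y else x) = (if i \<in> U then y else x)" by simp
    qed
    also have "\<dots> = x" using t xy i by (auto simp: cube_op_def)
    finally show ?thesis .
  qed
  ultimately show "cube_op B F I' W ?t" by (auto simp: cube_op_def)
qed

text \<open>
  The row \<open>r\<close> is replaced by the rows of \<open>I2\<close>: if \<open>r\<close> evaluates to \<open>b\<close> under \<open>(c, d)\<close>, then
  each new row is a row of the local cube term \<open>u\<close> evaluated under \<open>(c, b)\<close>.
\<close>
lemma cube_op_add_pair:
  assumes B: "algebra B F" "idempotent B F"
    and loc: "\<And>b. b \<in> B \<Longrightarrow> \<exists>n\<ge>1. \<exists>u. cube_op B F {1..n} {(c, b)} u"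
    and cd: "c \<in> B" "d \<in> B"
    and W: "W \<subseteq> B \<times> B"
    and fin: "finite I" "I \<noteq> {}" and t: "cube_op B F I W t"
    and bad: "bad \<subseteq> I" "\<forall>i\<in>I - bad. t (\<lambda>U. if i \<in> U then d else c) = c"
  shows "\<exists>I' t'. finite I' \<and> I' \<noteq> {} \<and> cube_op B F I' (insert (c, d) W) t'"
  using fin t bad
\<comment> \<open>\<open>bad\<close> contains the rows in which the identity for
  \<open>(c, d)\<close> may fail; each step trades one of them for rows in which it holds.\<close>
proof (induction "card bad" arbitrary: I t bad)
  case 0
  then have "bad = {}" using finite_subset by fastforce
  then show ?case using 0 by (intro exI[of _ I] exI[of _ t]) (auto simp: cube_op_def)
next
  case (Suc m)
  then obtain r where r: "r \<in> bad" by (metis card_eq_0_iff equals0I nat.distinct(1))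
  have tm: "term_over F (Pow I - {{}}) t" using Suc by (simp add: cube_op_def)
  define b where "b = t (\<lambda>U. if r \<in> U then d else c)"
  have "b \<in> B" unfolding b_def
    by (rule term_over_closed[OF B(1) tm]) (use cd in auto)
  then obtain n u0 where u0: "n \<ge> 1" "cube_op B F {1..n} {(c, b)} u0" using loc by blast
  \<comment> \<open>Shifting past \<open>Max I\<close> makes the new rows \<open>I2\<close> disjoint
    from \<open>I\<close>.\<close>
  define s where "s = Suc (Max I)"
  define I2 where "I2 = (\<lambda>i. s + i) ` {1..n}"
  have "bij_betw (\<lambda>i. s + i) {1..n} I2" by (auto simp: I2_def bij_betw_def inj_on_def)
  then obtain u where u: "cube_op B F I2 {(c, b)} u"
    using cube_op_reindex[OF u0(2)] by blast
  have I2: "I2 \<inter> I = {}" "I2 \<noteq> {}" "finite I2"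
    using u0(1) Max_ge[OF Suc(3)] by (fastforce simp: I2_def s_def)+
  have tmu: "term_over F (Pow I2 - {{}}) u" using u by (simp add: cube_op_def)
  \<comment> \<open>A column of the new matrix: if \<open>r\<close> lies in the column
    \<open>U\<close> of \<open>t\<close>, it is replaced by the rows in \<open>V\<close>.\<close>
  define \<phi> where "\<phi> V U = (U - {r}) \<union> (if r \<in> U then V else {})" for V U :: "nat set"
  define I' where "I' = (I - {r}) \<union> I2"
  define t' where "t' = (\<lambda>g. u (\<lambda>V. t (\<lambda>U. g (\<phi> V U))))"
  have "term_over F (Pow I' - {{}}) t'" unfolding t'_def
  proof (rule term_over_subst[OF tmu], rule term_over_rename[OF tm])
    fix V U assume "V \<in> Pow I2 - {{}}" "U \<in> Pow I - {{}}"
    then show "\<phi> V U \<in> Pow I' - {{}}" by (auto simp: \<phi>_def I'_def split: if_splits)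
  qed
  have row_old: "t' (\<lambda>U. if i \<in> U then y else x) = t (\<lambda>U. if i \<in> U then y else x)"
    if "i \<in> I - {r}" "x \<in> B" "y \<in> B" for i x y
  proof -
    have "i \<notin> I2" using that I2 by blast
    show ?thesis unfolding t'_def
    \<comment> \<open>In an old row the inner value does not depend on \<open>V\<close>, so
      idempotence of \<open>u\<close> applies.\<close>
    proof (rule term_over_const[OF B(2) tmu])
      show "t (\<lambda>U. if i \<in> U then y else x) \<in> B"
        by (rule term_over_closed[OF B(1) tm]) (use that in auto)
      fix V assume "V \<in> Pow I2 - {{}}"
      then have "i \<in> \<phi> V U \<longleftrightarrow> i \<in> U" for U using that \<open>i \<notin> I2\<close> by (auto simp: \<phi>_def)
      then show "t (\<lambda>U. if i \<in> \<phi> V U then y else x) = t (\<lambda>U. if i \<in> U then y else x)" by simp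
    qed
  qed
  have row_new: "t' (\<lambda>U. if i \<in> U then y else x)
      = u (\<lambda>V. if i \<in> V then t (\<lambda>U. if r \<in> U then y else x) else x)"
    if "i \<in> I2" "x \<in> B" "y \<in> B" for i x y
    unfolding t'_def
  proof (rule term_over_cong[OF tmu])
    fix V assume V: "V \<in> Pow I2 - {{}}"
    have "t (\<lambda>U. if i \<in> \<phi> V U then y else x) = t (\<lambda>U. if r \<in> U \<and> i \<in> V then y else x)"
    proof (rule term_over_cong[OF tm])
      fix U assume "U \<in> Pow I - {{}}"
      then have "i \<notin> U" using that I2 by blast
      then show "(if i \<in> \<phi> V U then y else x) = (if r \<in> U \<and> i \<in> V then y else x)"
        by (auto simp: \<phi>_def)
    qed
    also have "\<dots> = (if i \<in> V then t (\<lambda>U. if r \<in> U then y else x) else x)"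
      using term_over_idem[OF B(2) tm \<open>x \<in> B\<close>] by simp
    finally show "t (\<lambda>U. if i \<in> \<phi> V U then y else x)
        = (if i \<in> V then t (\<lambda>U. if r \<in> U then y else x) else x)" .
  qed
  have "r \<in> I" using r Suc by blast
  have row: "t' (\<lambda>U. if i \<in> U then y else x) = x" if "(x, y) \<in> W" "i \<in> I'" for x y i
  proof (cases "i \<in> I2")
    case True
    have "t (\<lambda>U. if r \<in> U then y else x) = x" using Suc(5) that \<open>r \<in> I\<close> by (auto simp: cube_op_def)
    moreover have "x \<in> B" "y \<in> B" using that W by auto
    ultimately show ?thesis using row_new[OF True] term_over_idem[OF B(2) tmu] by (simp cong: if_cong)
  next
    case False
    then have i: "i \<in> I - {r}" using that by (simp add: I'_def)
    moreover have "x \<in> B" "y \<in> B" using that W by auto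
    ultimately show ?thesis using row_old[OF i] Suc(5) that(1) by (auto simp: cube_op_def)
  qed
  have "t' (\<lambda>U. if i \<in> U then d else c) = c" if "i \<in> I' - (bad - {r})" for i
  proof (cases "i \<in> I2")
    case True
    then show ?thesis using row_new[OF True cd] u by (auto simp: cube_op_def b_def)
  next
    case False
    then have i: "i \<in> I - {r}" "i \<in> I - bad" using that by (auto simp: I'_def)
    then show ?thesis using row_old[OF i(1) cd] Suc(7) by auto
  qed
  moreover have "m = card (bad - {r})" using Suc(2) r by simp
  moreover have "cube_op B F I' W t'"
    using row \<open>term_over F (Pow I' - {{}}) t'\<close> by (auto simp: cube_op_def)
  moreover have "finite I'" "I' \<noteq> {}" "bad - {r} \<subseteq> I'" using I2 Suc by (auto simp: I'_def)
  ultimately show ?case using Suc(1)[of "bad - {r}" I' t'] by blast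
qed

lemma cube_op_global:
  assumes B: "algebra B F" "idempotent B F" "finite B"
    and loc: "\<And>c d. c \<in> B \<Longrightarrow> d \<in> B \<Longrightarrow> \<exists>n\<ge>1. \<exists>u. cube_op B F {1..n} {(c, d)} u"
  shows "\<exists>I t. finite I \<and> I \<noteq> {} \<and> cube_op B F I (B \<times> B) t"
proof -
  have "W \<subseteq> B \<times> B \<Longrightarrow> \<exists>I t. finite I \<and> I \<noteq> {} \<and> cube_op B F I W t" if "finite W" for W
    using that
  proof induction
    case empty
    have "cube_op B F {1} {} (\<lambda>g. g {1})" 
      using term_over_proj[of "{1::nat}" "Pow {1} - {{}}" F] by (simp add: cube_op_def)
    then show ?case by blast
  next
    case (insert p W)
    then obtain I t where It: "finite I" "I \<noteq> {}" "cube_op B F I W t" by auto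
    obtain c d where p: "p = (c, d)" by force
    show ?case unfolding p
      \<comment> \<open>With \<open>bad = I\<close> there is no row in which the new identity must
        be known beforehand.\<close>
      by (rule cube_op_add_pair[OF B(1,2) _ _ _ _ It, where bad = I]) (use loc insert p in auto)
  qed
  then show ?thesis using B(3) by simp
qed

text \<open>A formal column is recovered from the positions of \<open>Var_y\<close>; the empty set
  corresponds to the excluded column.\<close>

lemma bij_betw_patterns:
  "bij_betw (\<lambda>U. \<lambda>i\<in>I. if i \<in> U then Var_y else Var_x) (Pow I - {{}})
     ((I \<rightarrow>\<^sub>E {Var_x, Var_y}) - {\<lambda>i\<in>I. Var_x})"
proof -
  define p where "p U = (\<lambda>i\<in>I. if i \<in> U then Var_y else Var_x)" for U
  have p_empty: "p {} = (\<lambda>i\<in>I. Var_x)" by (simp add: p_def)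
  have left: "{i \<in> I. p U i = Var_y} = U" if "U \<subseteq> I" for U using that by (auto simp: p_def)
  have right: "p {i \<in> I. v i = Var_y} = v" if v: "v \<in> I \<rightarrow>\<^sub>E {Var_x, Var_y}" for v
  proof
    fix i
    show "p {i \<in> I. v i = Var_y} i = v i"
    proof (cases "i \<in> I")
      case True
      then have "v i = Var_x \<or> v i = Var_y" using PiE_mem[OF v True] by blast
      then show ?thesis using True by (auto simp: p_def)
    next
      case False
      then show ?thesis using PiE_arb[OF v False] by (simp add: p_def)
    qed
  qed
  have mem: "p U \<in> I \<rightarrow>\<^sub>E {Var_x, Var_y}" for U by (simp add: p_def)
  have "bij_betw p (Pow I) (I \<rightarrow>\<^sub>E {Var_x, Var_y})"
    by (rule bij_betw_byWitness[where f' = "\<lambda>v. {i \<in> I. v i = Var_y}"])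
      (use left right mem in blast)+
  then have "bij_betw p (Pow I - {{}}) ((I \<rightarrow>\<^sub>E {Var_x, Var_y}) - {p {}})"
    by (rule bij_betw_DiffI) (simp_all add: mem)
  then show ?thesis unfolding p_empty unfolding p_def .
qed

text \<open>Numbering the rows by \<open>h\<close> and the non-empty sets of rows by
  \<open>e\<close> turns the set encoding back into a cube matrix.\<close>

lemma cube_op_imp_has_cube_term:
  assumes B: "algebra B F" "idempotent B F"
    and I: "finite I" "I \<noteq> {}" and t0: "cube_op B F I (B \<times> B) t0"
  shows "has_cube_term B F"
proof -
  define k where "k = card I"
  define N :: nat where "N = 2 ^ k - 1"
  have k: "k \<ge> 1" using I by (simp add: k_def Suc_le_eq card_gt_0_iff)
  have "\<exists>h. bij_betw h I {1..k}"
    by (rule finite_same_card_bij) (use I in \<open>simp_all add: k_def\<close>)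
  then obtain h where h: "bij_betw h I {1..k}" ..
  obtain t where t: "cube_op B F {1..k} (B \<times> B) t"
    using cube_op_reindex[OF t0 h] ..
  have "card (Pow {1..k} - {{}}) = N" by (simp add: card_Diff_singleton card_Pow N_def)
  then have "\<exists>e. bij_betw e {1..N} (Pow {1..k} - {{}})"
    by (intro finite_same_card_bij) simp_all
  then obtain e where e: "bij_betw e {1..N} (Pow {1..k} - {{}})" ..
  define M where "M i j = (if i \<in> e j then Var_y else Var_x)" for i j
  have M: "cube_matrix k M"
    using bij_betw_trans[OF e bij_betw_patterns]
    unfolding cube_matrix_def M_def N_def comp_def tuples_def .
  have tm: "term_over F (Pow {1..k} - {{}}) t" using t by (simp add: cube_op_def)
  define t' where "t' = (\<lambda>g. t (\<lambda>U. g (inv_into {1..N} e U)))"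
  have tm': "term_over F {1..N} t'" unfolding t'_def
    by (rule term_over_image) (use tm e in \<open>simp only: bij_betw_def\<close>)
  define c where "c = (\<lambda>x\<in>tuples B N. t' x)"
  have "c (\<lambda>j\<in>{1..N}. assign x y (M i j)) = x" if "x \<in> B" "y \<in> B" "i \<in> {1..k}" for x y i
  proof -
    have "(\<lambda>j\<in>{1..N}. assign x y (M i j)) \<in> tuples B N"
      using that by (simp add: tuples_def M_def)
    then have "c (\<lambda>j\<in>{1..N}. assign x y (M i j)) = t' (\<lambda>j\<in>{1..N}. assign x y (M i j))"
      by (simp add: c_def)
    also have "\<dots> = t (\<lambda>U. if i \<in> U then y else x)" unfolding t'_def
    proof (rule term_over_cong[OF tm])
      fix U assume U: "U \<in> Pow {1..k} - {{}}"
      then have U': "U \<in> e ` {1..N}" using e by (simp add: bij_betw_def)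
      show "(\<lambda>j\<in>{1..N}. assign x y (M i j)) (inv_into {1..N} e U) = (if i \<in> U then y else x)"
        using inv_into_into[OF U'] f_inv_into_f[OF U'] by (simp add: M_def)
    qed
    also have "\<dots> = x" using t that by (simp add: cube_op_def)
    finally show ?thesis .
  qed
  moreover have "(N, c) \<in> term_operations B F"
    using term_over_imp_term_operation[OF tm'] unfolding c_def .
  ultimately have "cube_term B F k c"
    unfolding cube_term_def N_def[symmetric] by (intro conjI exI[of _ M] M ballI)
  then show ?thesis using k by (auto simp: has_cube_term_def)
qed

subsection \<open>Continuum many clonoids\<close>

definition eval_tuple :: "'x set \<Rightarrow> ((('x \<Rightarrow> 'b) \<Rightarrow> 'b) \<Rightarrow> 'b) \<Rightarrow> 'x \<Rightarrow> 'b" where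
  "eval_tuple X t = (\<lambda>x\<in>X. t (\<lambda>g. g x))"

text \<open>The generators themselves serve as the variables of the terms, and evaluation is
  coordinatewise.\<close>

definition generated :: "('b, 'b) finitary set \<Rightarrow> 'x set \<Rightarrow> ('x \<Rightarrow> 'b) set \<Rightarrow> ('x \<Rightarrow> 'b) set" where
  "generated F X G = eval_tuple X ` Collect (term_over F G)"

lemma subalgebra_generated:
  assumes B: "algebra B F" and G: "G \<subseteq> X \<rightarrow>\<^sub>E B"
  shows "subalgebra_of_power X B F (generated F X G)"
  unfolding subalgebra_of_power_def
proof (intro conjI subsetI ballI, goal_cases)
  case (1 v)
  then obtain t where t: "term_over F G t" "v = eval_tuple X t" unfolding generated_def by blast
  have "t (\<lambda>g. g x) \<in> B" if "x \<in> X" for x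
    by (rule term_over_closed[OF B t(1)]) (use G that in blast)
  then show ?case using t(2) by (simp add: eval_tuple_def)
next
  case (2 nf)
  obtain n f where nf: "nf = (n, f)" by force
  have "pointwise X n f v \<in> generated F X G" if v: "v \<in> {1..n} \<rightarrow> generated F X G" for v
  proof -
    have "\<forall>i\<in>{1..n}. \<exists>t. term_over F G t \<and> v i = eval_tuple X t"
      using v unfolding generated_def by fast
    then obtain t where t: "\<forall>i\<in>{1..n}. term_over F G (t i) \<and> v i = eval_tuple X (t i)" by metis
    have tm: "term_over F G (\<lambda>g. f (\<lambda>i\<in>{1..n}. t i g))"
      by (rule term_over_op) (use 2 nf t in blast)+
    have "pointwise X n f v = eval_tuple X (\<lambda>g. f (\<lambda>i\<in>{1..n}. t i g))"
      unfolding pointwise_def eval_tuple_def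
    proof (rule restrict_ext)
      fix x assume "x \<in> X"
      then have "(\<lambda>i\<in>{1..n}. v i x) = (\<lambda>i\<in>{1..n}. t i (\<lambda>g. g x))"
        using t by (intro restrict_ext) (simp add: eval_tuple_def)
      then show "f (\<lambda>i\<in>{1..n}. v i x) = f (\<lambda>i\<in>{1..n}. t i (\<lambda>g. g x))" by simp
    qed
    then show ?thesis unfolding generated_def using tm by blast
  qed
  then show ?case using nf by blast
qed

lemma generated_superset:
  assumes "G \<subseteq> X \<rightarrow>\<^sub>E B" shows "G \<subseteq> generated F X G"
proof
  fix g assume g: "g \<in> G"
  then have "g = eval_tuple X (\<lambda>h. h g)"
    unfolding eval_tuple_def using assms PiE_restrict by (metis subsetD)
  then show "g \<in> generated F X G" unfolding generated_def using term_over_proj[OF g] by blast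
qed

definition pattern :: "nat set \<Rightarrow> 'b \<Rightarrow> 'b \<Rightarrow> nat set \<Rightarrow> nat \<Rightarrow> 'b" where
  "pattern I c d U = (\<lambda>i\<in>I. if i \<in> U then d else c)"

text \<open>This is \<open>T\<^sub>n\<close> of the overview; \<open>U\<close> marks the entries
  \<open>d\<close> of a generator.\<close>

definition cube_relation :: "('b, 'b) finitary set \<Rightarrow> 'b \<Rightarrow> 'b \<Rightarrow> nat \<Rightarrow> (nat \<Rightarrow> 'b) set" where
  "cube_relation F c d n = generated F {1..n} (pattern {1..n} c d ` (Pow {1..n} - {{}}))"

lemma pattern_PiE: "c \<in> B \<Longrightarrow> d \<in> B \<Longrightarrow> pattern I c d U \<in> I \<rightarrow>\<^sub>E B"
  by (simp add: pattern_def)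

lemma subalgebra_cube_relation:
  assumes "algebra B F" "c \<in> B" "d \<in> B"
  shows "subalgebra_of_power {1..n} B F (cube_relation F c d n)"
  unfolding cube_relation_def
  by (intro subalgebra_generated image_subsetI pattern_PiE assms)

lemma pattern_in_cube_relation:
  assumes "c \<in> B" "d \<in> B" "U \<subseteq> {1..n}" "U \<noteq> {}"
  shows "pattern {1..n} c d U \<in> cube_relation F c d n"
proof -
  let ?G = "pattern {1..n} c d ` (Pow {1..n} - {{}})"
  have "?G \<subseteq> generated F {1..n} ?G"
    by (intro generated_superset[of _ _ B] image_subsetI pattern_PiE assms)
  moreover have "pattern {1..n} c d U \<in> ?G" using assms by blast
  ultimately show ?thesis unfolding cube_relation_def by (rule subsetD)
qed

text \<open>A term yielding the constant tuple becomes a cube operation for \<open>(c, d)\<close>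
  once each generator, read as a variable, is replaced by its index set.\<close>

lemma const_notin_cube_relation:
  assumes "\<nexists>u. cube_op B F {1..n} {(c, d)} u"
  shows "(\<lambda>i\<in>{1..n}. c) \<notin> cube_relation F c d n"
proof
  let ?P = "Pow {1..n} - {{}}" and ?h = "pattern {1..n} c d"
  assume "(\<lambda>i\<in>{1..n}. c) \<in> cube_relation F c d n"
  then obtain t where t: "term_over F (?h ` ?P) t" "(\<lambda>i\<in>{1..n}. c) = eval_tuple {1..n} t"
    unfolding cube_relation_def generated_def by blast
  \<comment> \<open>For \<open>c = d\<close> different index sets may give the same pattern;
    \<open>inv_into\<close> selects one of them, and only its right-inverse property is
    used.\<close>
  define u where "u = (\<lambda>g. t (\<lambda>j. g (inv_into ?P ?h j)))"
  have "term_over F ?P u" unfolding u_def by (rule term_over_image[OF t(1)])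
  moreover have "u (\<lambda>U. if i \<in> U then d else c) = c" if i: "i \<in> {1..n}" for i
  proof -
    have "u (\<lambda>U. if i \<in> U then d else c) = t (\<lambda>g. g i)" unfolding u_def
    proof (rule term_over_cong[OF t(1)])
      fix g assume "g \<in> ?h ` ?P"
      then have "?h (inv_into ?P ?h g) i = g i" by (simp add: f_inv_into_f)
      then show "(if i \<in> inv_into ?P ?h g then d else c) = g i" using i by (simp add: pattern_def)
    qed
    also have "\<dots> = c" using fun_cong[OF t(2), of i] i by (simp add: eval_tuple_def)
    finally show ?thesis .
  qed
  ultimately have "cube_op B F {1..n} {(c, d)} u" by (simp add: cube_op_def)
  then show False using assms by blast
qed

text \<open>
  The matrix whose columns are the unit vectors \<open>e (p 1), \<dots>, e (p k)\<close> of \<open>{z, l}\<^sup>n\<close>; its row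
  \<open>i\<close> is the indicator of the fibre of \<open>p\<close> over \<open>i\<close>.
\<close>
definition unit_rows :: "'a \<Rightarrow> 'a \<Rightarrow> nat \<Rightarrow> (nat \<Rightarrow> nat) \<Rightarrow> nat \<Rightarrow> nat \<Rightarrow> 'a" where
  "unit_rows z l k p i = (\<lambda>j\<in>{1..k}. if p j = i then l else z)"

text \<open>Preservation of the pairs \<open>P\<^sub>n\<close>, \<open>T\<^sub>n\<close> of the
  overview: \<open>p\<close> chooses \<open>k\<close> unit vectors as columns, and \<open>f\<close>
  is applied to the rows. The shift to \<open>Suc n\<close> lets \<open>N\<close> be any set of
  naturals while the relations have positive arity.\<close>

definition polymorphism_clonoid ::
    "'a set \<Rightarrow> 'b set \<Rightarrow> 'a \<Rightarrow> 'a \<Rightarrow> (nat \<Rightarrow> (nat \<Rightarrow> 'b) set) \<Rightarrow> nat set \<Rightarrow> ('a, 'b) finitary set" where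
  "polymorphism_clonoid A B z l T N = {(k, f). 1 \<le> k \<and> f \<in> tuples A k \<rightarrow>\<^sub>E B \<and>
     (\<forall>n\<in>N. \<forall>p\<in>{1..k} \<rightarrow> {1..Suc n}. (\<lambda>i\<in>{1..Suc n}. f (unit_rows z l k p i)) \<in> T (Suc n))}"

lemma unit_rows_tuples: "z \<in> A \<Longrightarrow> l \<in> A \<Longrightarrow> unit_rows z l k p i \<in> tuples A k"
  by (simp add: unit_rows_def tuples_def)

lemma minor_PiE:
  assumes "f \<in> tuples A k \<rightarrow>\<^sub>E B" "\<sigma> \<in> {1..k} \<rightarrow> {1..m}"
  shows "minor A k m f \<sigma> \<in> tuples A m \<rightarrow>\<^sub>E B"
proof -
  have "f (\<lambda>i\<in>{1..k}. x (\<sigma> i)) \<in> B" if "x \<in> tuples A m" for x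
  proof (rule PiE_mem[OF assms(1)])
    show "(\<lambda>i\<in>{1..k}. x (\<sigma> i)) \<in> tuples A k"
      using that assms(2) unfolding tuples_def by fastforce
  qed
  then show ?thesis by (simp add: minor_def)
qed

lemma clonoid_polymorphism:
  assumes B: "algebra B F" and zl: "z \<in> A" "l \<in> A"
    and T: "\<And>n. subalgebra_of_power {1..n} B F (T n)"
  shows "clonoid A B F (polymorphism_clonoid A B z l T N)" (is "clonoid A B F ?C")
  unfolding clonoid_def
proof (intro conjI)
  show "?C \<subseteq> {(n, f). 1 \<le> n \<and> f \<in> tuples A n \<rightarrow>\<^sub>E B}"
    unfolding polymorphism_clonoid_def by blast
  have "(m, minor A k m f \<sigma>) \<in> ?C"
    if kf: "(k, f) \<in> ?C" and m: "m \<ge> 1" "\<sigma> \<in> {1..k} \<rightarrow> {1..m}" for k f m \<sigma>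
  proof -
    have f: "f \<in> tuples A k \<rightarrow>\<^sub>E B"
      and pol: "\<And>n p. n \<in> N \<Longrightarrow> p \<in> {1..k} \<rightarrow> {1..Suc n}
        \<Longrightarrow> (\<lambda>i\<in>{1..Suc n}. f (unit_rows z l k p i)) \<in> T (Suc n)"
      using kf by (auto simp: polymorphism_clonoid_def)
    have "(\<lambda>i\<in>{1..Suc n}. minor A k m f \<sigma> (unit_rows z l m p i)) \<in> T (Suc n)"
      if "n \<in> N" "p \<in> {1..m} \<rightarrow> {1..Suc n}" for n p
    proof -
      \<comment> \<open>Taking a minor only changes the choice of columns from \<open>p\<close> to
        its composition with \<open>\<sigma>\<close>.\<close>
      have "minor A k m f \<sigma> (unit_rows z l m p i) = f (unit_rows z l k (\<lambda>j. p (\<sigma> j)) i)" for i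
      proof -
        have "(\<lambda>j\<in>{1..k}. unit_rows z l m p i (\<sigma> j)) = unit_rows z l k (\<lambda>j. p (\<sigma> j)) i"
          unfolding unit_rows_def using m(2) by (intro restrict_ext) (simp add: Pi_iff)
        then show ?thesis using unit_rows_tuples[OF zl] by (simp add: minor_def)
      qed
      moreover have "(\<lambda>j. p (\<sigma> j)) \<in> {1..k} \<rightarrow> {1..Suc n}" using that m(2) by fast
      ultimately show ?thesis using pol[OF that(1)] by simp
    qed
    then show ?thesis using minor_PiE[OF f m(2)] m(1) by (simp add: polymorphism_clonoid_def)
  qed
  then show "\<forall>(k, f)\<in>?C. \<forall>m\<ge>1. \<forall>\<sigma>\<in>{1..k} \<rightarrow> {1..m}. (m, minor A k m f \<sigma>) \<in> ?C" by blast
  show "\<forall>k\<ge>1. subalgebra_of_power (tuples A k) B F {f. (k, f) \<in> ?C}"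
    unfolding subalgebra_of_power_def
  proof (intro allI impI conjI ballI)
    fix k :: nat assume k: "k \<ge> 1"
    show "{f. (k, f) \<in> ?C} \<subseteq> tuples A k \<rightarrow>\<^sub>E B" by (auto simp: polymorphism_clonoid_def)
    fix rh assume rh: "rh \<in> F"
    obtain r h where rh_eq: "rh = (r, h)" by force
    have "pointwise (tuples A k) r h g \<in> {f. (k, f) \<in> ?C}" if g: "g \<in> {1..r} \<rightarrow> {f. (k, f) \<in> ?C}" for g
    proof -
      have gf: "g i \<in> tuples A k \<rightarrow>\<^sub>E B" if "i \<in> {1..r}" for i
        using g that by (auto simp: polymorphism_clonoid_def)
      have h: "h \<in> tuples B r \<rightarrow>\<^sub>E B" using B rh rh_eq by (auto simp: algebra_def)
      have "h (\<lambda>i\<in>{1..r}. g i x) \<in> B" if "x \<in> tuples A k" for x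
        by (rule PiE_mem[OF h]) (use PiE_mem[OF gf that] in \<open>simp add: tuples_def\<close>)
      then have "pointwise (tuples A k) r h g \<in> tuples A k \<rightarrow>\<^sub>E B" by (simp add: pointwise_def)
      moreover have "(\<lambda>i\<in>{1..Suc n}. pointwise (tuples A k) r h g (unit_rows z l k p i)) \<in> T (Suc n)"
        if "n \<in> N" "p \<in> {1..k} \<rightarrow> {1..Suc n}" for n p
      proof -
        let ?v = "\<lambda>j. \<lambda>i\<in>{1..Suc n}. g j (unit_rows z l k p i)"
        have "?v \<in> {1..r} \<rightarrow> T (Suc n)"
        proof
          fix j assume "j \<in> {1..r}"
          then have "(k, g j) \<in> ?C" using g by blast
          then show "?v j \<in> T (Suc n)" using that by (simp add: polymorphism_clonoid_def)
        qed
        then have "pointwise {1..Suc n} r h ?v \<in> T (Suc n)"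
          using T[of "Suc n"] rh rh_eq unfolding subalgebra_of_power_def by blast
        moreover have "pointwise {1..Suc n} r h ?v
            = (\<lambda>i\<in>{1..Suc n}. pointwise (tuples A k) r h g (unit_rows z l k p i))"
          unfolding pointwise_def[of "{1..Suc n}"]
          by (rule restrict_ext) (simp add: pointwise_def unit_rows_tuples[OF zl])
        ultimately show ?thesis by (simp only:)
      qed
      ultimately show ?thesis using k by (simp add: polymorphism_clonoid_def)
    qed
    then show "case rh of (r, h) \<Rightarrow> \<forall>g\<in>{1..r} \<rightarrow> {f. (k, f) \<in> ?C}.
        pointwise (tuples A k) r h g \<in> {f. (k, f) \<in> ?C}"
      unfolding rh_eq by blast
  qed
qed

definition unit_test :: "'a set \<Rightarrow> 'a \<Rightarrow> 'a \<Rightarrow> 'b \<Rightarrow> 'b \<Rightarrow> nat \<Rightarrow> (nat \<Rightarrow> 'a) \<Rightarrow> 'b" where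
  "unit_test A z l c d m =
     (\<lambda>x\<in>tuples A m. if \<exists>j\<in>{1..m}. x = unit_rows z l m id j then c else d)"

text \<open>For \<open>m \<in> N\<close> the columns chosen by \<open>id\<close> produce the omitted
  constant tuple. For \<open>m \<notin> N\<close> no choice of columns makes every row a unit
  vector, so only generators of the cube relation are produced.\<close>

lemma unit_test_in_polymorphism_clonoid:
  assumes zl: "z \<in> A" "l \<in> A" "z \<noteq> l" and cd: "c \<in> B" "d \<in> B"
    and no: "\<And>n. n \<ge> 1 \<Longrightarrow> \<nexists>u. cube_op B F {1..n} {(c, d)} u"
  shows "(Suc m, unit_test A z l c d (Suc m)) \<in> polymorphism_clonoid A B z l (cube_relation F c d) N
    \<longleftrightarrow> m \<notin> N"
proof
  let ?f = "unit_test A z l c d (Suc m)"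
  assume inC: "(Suc m, ?f) \<in> polymorphism_clonoid A B z l (cube_relation F c d) N"
  show "m \<notin> N"
  proof
    assume "m \<in> N"
    have "id \<in> {1..Suc m} \<rightarrow> {1..Suc m}" by simp
    then have "(\<lambda>i\<in>{1..Suc m}. ?f (unit_rows z l (Suc m) id i)) \<in> cube_relation F c d (Suc m)"
      using inC \<open>m \<in> N\<close> unfolding polymorphism_clonoid_def by blast
    moreover have "(\<lambda>i\<in>{1..Suc m}. ?f (unit_rows z l (Suc m) id i)) = (\<lambda>i\<in>{1..Suc m}. c)"
    proof (rule restrict_ext)
      fix i assume "i \<in> {1..Suc m}"
      then show "?f (unit_rows z l (Suc m) id i) = c"
        unfolding unit_test_def using unit_rows_tuples[OF zl(1,2)] by (simp only: restrict_apply) metis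
    qed
    ultimately show False using const_notin_cube_relation[OF no[of "Suc m"]] by simp
  qed
next
  let ?f = "unit_test A z l c d (Suc m)"
  assume m: "m \<notin> N"
  have "(\<lambda>i\<in>{1..Suc n}. ?f (unit_rows z l (Suc m) p i)) \<in> cube_relation F c d (Suc n)"
    if n: "n \<in> N" and p: "p \<in> {1..Suc m} \<rightarrow> {1..Suc n}" for n p
  proof -
    \<comment> \<open>\<open>U\<close> consists of the rows with value \<open>d\<close>; it remains
      to see that it is non-empty.\<close>
    define U where "U = {i \<in> {1..Suc n}. \<not> (\<exists>j\<in>{1..Suc m}. unit_rows z l (Suc m) p i = unit_rows z l (Suc m) id j)}"
    have "(\<lambda>i\<in>{1..Suc n}. ?f (unit_rows z l (Suc m) p i)) = pattern {1..Suc n} c d U"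
      unfolding pattern_def
    proof (rule restrict_ext)
      fix i assume "i \<in> {1..Suc n}"
      then show "?f (unit_rows z l (Suc m) p i) = (if i \<in> U then d else c)"
        using unit_rows_tuples[OF zl(1,2)] by (simp add: unit_test_def U_def)
    qed
    moreover have "U \<noteq> {}"
    proof
      assume "U = {}"
      \<comment> \<open>If every row is a unit vector, then every fibre of \<open>p\<close> is a
        singleton; so \<open>p\<close> is a bijection, which forces \<open>m = n\<close>.\<close>
      have ex: "\<exists>j\<in>{1..Suc m}. \<forall>j'\<in>{1..Suc m}. p j' = i \<longleftrightarrow> j' = j" if i: "i \<in> {1..Suc n}" for i
      proof -
        have "i \<notin> U" using \<open>U = {}\<close> by simp
        then obtain j where j: "j \<in> {1..Suc m}" "unit_rows z l (Suc m) p i = unit_rows z l (Suc m) id j"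
          using i unfolding U_def by blast
        have "p j' = i \<longleftrightarrow> j' = j" if "j' \<in> {1..Suc m}" for j'
          using fun_cong[OF j(2), of j'] that zl(3) by (simp add: unit_rows_def split: if_splits)
        then show ?thesis using j(1) by blast
      qed
      have "inj_on p {1..Suc m}"
      proof (rule inj_onI)
        fix x y assume xy: "x \<in> {1..Suc m}" "y \<in> {1..Suc m}" "p x = p y"
        then have "p x \<in> {1..Suc n}" using p by blast
        from ex[OF this] show "x = y" using xy by metis
      qed
      moreover have "p ` {1..Suc m} = {1..Suc n}"
      proof
        show "p ` {1..Suc m} \<subseteq> {1..Suc n}" using p by blast
        show "{1..Suc n} \<subseteq> p ` {1..Suc m}"
        proof
          fix i assume "i \<in> {1..Suc n}"
          from ex[OF this] show "i \<in> p ` {1..Suc m}" by (metis imageI)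
        qed
      qed
      ultimately have "card {1..Suc m} = card {1..Suc n}"
        by (metis card_image)
      then show False using n m by simp
    qed
    moreover have "U \<subseteq> {1..Suc n}" by (auto simp: U_def)
    ultimately show ?thesis using pattern_in_cube_relation[OF cd, of U "Suc n" F] by simp
  qed
  moreover have "?f \<in> tuples A (Suc m) \<rightarrow>\<^sub>E B" using cd by (simp add: unit_test_def)
  ultimately show "(Suc m, ?f) \<in> polymorphism_clonoid A B z l (cube_relation F c d) N"
    by (simp add: polymorphism_clonoid_def)
qed

text \<open>By the composition of local cube operations, some pair \<open>(c, d)\<close> admits none
  in any dimension. For this pair the unit tests separate the clonoids of different sets
  \<open>N\<close>.\<close>

lemma nat_sets_lepoll_clonoids:
  assumes B: "algebra B F" "idempotent B F" "finite B" and A: "card A > 1"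
    and no: "\<not> has_cube_term B F"
  shows "(UNIV :: nat set set) \<lesssim> clonoids A B F"
proof -
  obtain z l where zl: "z \<in> A" "l \<in> A" "z \<noteq> l"
    using A by (metis One_nat_def card_le_Suc0_iff_eq card_ge_0_finite gr_implies_not0 leD not_gr_zero)
  have "\<not> (\<forall>c\<in>B. \<forall>d\<in>B. \<exists>n\<ge>1. \<exists>u. cube_op B F {1..n} {(c, d)} u)"
    using cube_op_global[OF B] cube_op_imp_has_cube_term[OF B(1,2)] no by metis
  then obtain c d where cd: "c \<in> B" "d \<in> B" "\<And>n. n \<ge> 1 \<Longrightarrow> \<nexists>u. cube_op B F {1..n} {(c, d)} u" by blast
  let ?C = "polymorphism_clonoid A B z l (cube_relation F c d)"
  have "inj ?C"
  proof (rule injI)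
    fix M N assume "?C M = ?C N"
    then have "m \<in> M \<longleftrightarrow> m \<in> N" for m
      using unit_test_in_polymorphism_clonoid[OF zl cd, of m] by blast
    then show "M = N" by blast
  qed
  moreover have "range ?C \<subseteq> clonoids A B F"
    using clonoid_polymorphism[OF B(1) zl(1,2) subalgebra_cube_relation[OF B(1) cd(1,2)]]
    by (auto simp: clonoids_def)
  ultimately show ?thesis unfolding lepoll_def by blast
qed

section \<open>Upper bound on the number of clonoids\<close>

lemma finite_tuples: "finite A \<Longrightarrow> finite (tuples A k)"
  by (simp add: tuples_def finite_PiE)

text \<open>Since \<open>A\<close> and \<open>B\<close> are finite, clonoids are subsets of a
  countable set.\<close>

lemma clonoids_lepoll_reals:
  assumes "finite A" "finite B"
  shows "clonoids A B F \<lesssim> (UNIV :: real set)"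
proof -
  let ?Fn = "SIGMA n:UNIV. tuples A n \<rightarrow>\<^sub>E B"
  have "countable ?Fn"
    using assms by (intro countable_SIGMA) (auto intro!: countable_finite finite_PiE finite_tuples)
  then obtain h :: "_ \<Rightarrow> nat" where h: "inj_on h ?Fn" by (auto simp: countable_def)
  have "clonoids A B F \<subseteq> Pow ?Fn" by (auto simp: clonoids_def clonoid_def)
  then have "inj_on ((`) h) (clonoids A B F)"
    using inj_on_image_Pow[OF h] inj_on_subset by blast
  then have "clonoids A B F \<lesssim> (UNIV :: nat set set)" unfolding lepoll_def by blast
  then show ?thesis
    using nat_sets_eqpoll_reals lepoll_trans eqpoll_imp_lepoll by blast
qed

lemma clonoids_eqpoll_reals:
  assumes "finite A" "finite B" "algebra B F" "idempotent B F" "card A > 1" "\<not> has_cube_term B F"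
  shows "clonoids A B F \<approx> (UNIV :: real set)"
  by (meson assms clonoids_lepoll_reals nat_sets_lepoll_clonoids nat_sets_eqpoll_reals
      eqpoll_imp_lepoll eqpoll_sym lepoll_antisym lepoll_trans)

subsection \<open>Edge terms\<close>

text \<open>As in \<open>cube_op\<close>, but with an arbitrary family of columns. The row index
  \<open>r\<close> ranges over all naturals: a row that meets no column expresses
  idempotence.\<close>

definition family_op ::
    "'b set \<Rightarrow> ('b, 'b) finitary set \<Rightarrow> nat set set \<Rightarrow> ((nat set \<Rightarrow> 'b) \<Rightarrow> 'b) \<Rightarrow> bool" where
  "family_op B F S t \<longleftrightarrow> term_over F S t \<and> (\<forall>r. \<forall>x\<in>B. \<forall>y\<in>B. t (\<lambda>U. if r \<in> U then y else x) = x)"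

lemma has_cube_term_imp_family_op:
  assumes B: "algebra B F" "idempotent B F" and c: "has_cube_term B F"
  shows "\<exists>k t. family_op B F (Pow {1..k} - {{}}) t"
proof -
  obtain k c M where k: "k \<ge> 1" "(2 ^ k - 1, c) \<in> term_operations B F" "cube_matrix k M"
    and cM: "\<forall>x\<in>B. \<forall>y\<in>B. \<forall>i\<in>{1..k}. c (\<lambda>j\<in>{1..2 ^ k - 1}. assign x y (M i j)) = x"
    using c unfolding has_cube_term_def cube_term_def by blast
  define N :: nat where "N = 2 ^ k - 1"
  obtain t where t: "term_over F {1..N} t" "\<forall>x\<in>tuples B N. c x = t x"
    using term_operation_imp_term_over[OF B(1) k(2)] unfolding N_def by blast
  define e where "e j = {i \<in> {1..k}. M i j = Var_y}" for j
  have "e j \<in> Pow {1..k} - {{}}" if j: "j \<in> {1..N}" for j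
  proof -
    have "(\<lambda>i\<in>{1..k}. M i j) \<noteq> (\<lambda>i\<in>{1..k}. Var_x)"
      using bij_betw_apply[OF k(3)[unfolded cube_matrix_def], of j] j by (simp add: N_def)
    then obtain i where "(\<lambda>i\<in>{1..k}. M i j) i \<noteq> (\<lambda>i\<in>{1..k}. Var_x) i" by blast
    then have "i \<in> {1..k}" "M i j \<noteq> Var_x" by (auto split: if_splits)
    then have "i \<in> e j" using formal_var.exhaust by (auto simp: e_def)
    then show ?thesis by (auto simp: e_def)
  qed
  then have tm: "term_over F (Pow {1..k} - {{}}) (\<lambda>g. t (\<lambda>j. g (e j)))" by (rule term_over_rename[OF t(1)])
  have "t (\<lambda>j. if r \<in> e j then y else x) = x" if xy: "x \<in> B" "y \<in> B" for r x y
  proof (cases "r \<in> {1..k}")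
    case True
    have "assign x y (M r j) = (if r \<in> e j then y else x)" for j
      using True by (cases "M r j") (auto simp: e_def)
    then have "(\<lambda>j\<in>{1..N}. if r \<in> e j then y else x) = (\<lambda>j\<in>{1..N}. assign x y (M r j))" by simp
    then have "c (\<lambda>j\<in>{1..N}. if r \<in> e j then y else x) = x"
      using cM xy True by (simp add: N_def)
    moreover have "(\<lambda>j\<in>{1..N}. if r \<in> e j then y else x) \<in> tuples B N"
      using xy by (simp add: tuples_def)
    ultimately have "t (\<lambda>j\<in>{1..N}. if r \<in> e j then y else x) = x" using t(2) by metis
    moreover have "t (\<lambda>j\<in>{1..N}. if r \<in> e j then y else x) = t (\<lambda>j. if r \<in> e j then y else x)"
      by (rule term_over_cong[OF t(1)]) simp
    ultimately show ?thesis by simp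
  next
    case False
    then have "r \<notin> e j" for j by (auto simp: e_def)
    then show ?thesis using term_over_idem[OF B(2) t(1) xy(1)] by simp
  qed
  then have "family_op B F (Pow {1..k} - {{}}) (\<lambda>g. t (\<lambda>j. g (e j)))"
    using tm by (simp add: family_op_def)
  then show ?thesis by blast
qed

lemma family_op_mono: "family_op B F S t \<Longrightarrow> S \<subseteq> S' \<Longrightarrow> family_op B F S' t"
  unfolding family_op_def using term_over_mono by blast

text \<open>\<open>I\<close> contains the rows still linked to \<open>j\<close>; for
  \<open>I = {}\<close> the row \<open>j\<close> occurs in \<open>{j}\<close> only, apart from the
  untouched columns \<open>Z\<close>.\<close>

definition linked_family :: "nat set \<Rightarrow> nat \<Rightarrow> nat set \<Rightarrow> nat set set \<Rightarrow> nat set set" where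
  "linked_family P j I Z = (Pow P - {{}}) \<union> insert j ` Pow I \<union> Z"

text \<open>
  One unlinks \<open>i\<close> from \<open>j\<close> by substituting the operation into itself.  The substitution \<open>\<phi>\<close>
  arranges that in column \<open>U\<close> row \<open>r\<close> evaluates to \<open>x\<close> if \<open>r \<notin> U\<close>, and otherwise to a value \<open>q r\<close>
  independent of \<open>U\<close>; this is \<open>y\<close> for \<open>r \<noteq> i, j\<close>.
\<close>
lemma family_op_unlink:
  assumes B: "algebra B F" "idempotent B F"
    and t: "family_op B F (linked_family P j I Z) t"
    and I: "I \<subseteq> P" "i \<in> I" and i': "i' \<in> P" "i' \<noteq> i" and j: "j \<notin> P"
    and Z: "\<And>U. U \<in> Z \<Longrightarrow> U \<inter> insert j P = {}"  "{} \<notin> Z"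
  shows "\<exists>t'. family_op B F (linked_family P j (I - {i}) Z) t'"
proof
  let ?S = "linked_family P j I Z" and ?S' = "linked_family P j (I - {i}) Z"
  \<comment> \<open>\<open>U\<close> is the outer and \<open>V\<close> the inner column. For
    \<open>U = {i}\<close> and \<open>V = {j}\<close> the row \<open>i\<close> is dropped, and
    \<open>i'\<close> keeps the column non-empty; row \<open>i'\<close> then copies row
    \<open>j\<close> of the inner matrix and evaluates to \<open>x\<close>.\<close>
  define \<phi> where "\<phi> U V =
    (if U = {j} then (if V = {j} then {j} else V - {j})
     else if U = {i} then (if V \<noteq> {j} then {i} else {}) \<union> (if j \<in> V then {i'} else {})
     else (U - {i, j}) \<union> (if i \<in> U \<and> V \<noteq> {j} then {i} else {})
       \<union> (if j \<in> U \<and> V = {j} then {j} else {}))" for U V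
  have tm: "term_over F ?S t" using t by (simp add: family_op_def)
  have row_t: "t (\<lambda>U. if r \<in> U then y else x) = x" if "x \<in> B" "y \<in> B" for r x y
    using t that by (simp add: family_op_def)
  define t' where "t' = (\<lambda>g. t (\<lambda>U. t (\<lambda>V. g (\<phi> U V))))"
  have \<phi>: "\<phi> U V \<in> ?S'" if "U \<in> ?S" "V \<in> ?S" for U V
  proof -
    have ij: "i \<in> P" "i \<noteq> j" "i' \<noteq> j" using I i' j by auto
    have "U \<in> Pow P - {{}} \<or> U \<in> insert j ` Pow I \<or> U \<in> Z"
      using that(1) by (simp only: linked_family_def Un_iff disj_assoc)
    then consider "U = {j}" | "U = {i}" | "U \<noteq> {j}" "U \<noteq> {i}" "U \<subseteq> P" "U \<noteq> {}"
      | U0 where "U \<noteq> {j}" "U = insert j U0" "U0 \<subseteq> I" | "U \<in> Z"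
      by (elim disjE imageE) (simp_all only: Diff_iff Pow_iff insert_iff, metis+)
    then show ?thesis
    proof cases
      case 1
      then have "\<phi> U V = (if V = {j} then {j} else V - {j})" by (simp add: \<phi>_def)
      moreover have "V - {j} \<in> ?S'" if "V \<noteq> {j}"
      proof (cases "V \<in> Z")
        case True
        then have "V - {j} = V" using Z by blast
        then show ?thesis using True by (simp add: linked_family_def)
      next
        case False
        then have "V - {j} \<subseteq> P" "V - {j} \<noteq> {}"
          using \<open>V \<in> ?S\<close> that I j unfolding linked_family_def by auto
        then show ?thesis by (simp add: linked_family_def)
      qed
      moreover have "{j} \<in> ?S'" by (auto simp: linked_family_def)
      ultimately show ?thesis by simp
    next
      case 2
      then have "\<phi> U V = (if V \<noteq> {j} then {i} else {}) \<union> (if j \<in> V then {i'} else {})"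
        using ij by (simp add: \<phi>_def)
      moreover have "\<dots> \<subseteq> P" "\<dots> \<noteq> {}" using ij i' by auto
      ultimately show ?thesis by (simp add: linked_family_def)
    next
      case 3
      then have "j \<notin> U" using j by blast
      then have "\<phi> U V = (U - {i}) \<union> (if i \<in> U \<and> V \<noteq> {j} then {i} else {})"
        using 3 by (auto simp: \<phi>_def)
      moreover have "\<dots> \<subseteq> P" "\<dots> \<noteq> {}" using 3 ij by auto
      ultimately show ?thesis by (simp add: linked_family_def)
    next
      case 4
      then have "j \<notin> U0" "U0 \<noteq> {}" using I j by blast+
      show ?thesis
      proof (cases "V = {j}")
        case True
        then have "\<phi> U V = insert j (U0 - {i})"
          using 4 \<open>j \<notin> U0\<close> ij by (auto simp: \<phi>_def)
        moreover have "U0 - {i} \<in> Pow (I - {i})" using 4 by blast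
        ultimately show ?thesis by (simp only: linked_family_def Un_iff imageI simp_thms)
      next
        case False
        then have "\<phi> U V = U0" using 4 \<open>j \<notin> U0\<close> ij by (auto simp: \<phi>_def)
        moreover have "U0 \<in> Pow P - {{}}" using 4 I \<open>U0 \<noteq> {}\<close> by blast
        ultimately show ?thesis by (simp only: linked_family_def Un_iff simp_thms)
      qed
    next
      case 5
      then have "i \<notin> U" "j \<notin> U" "U \<noteq> {}" using Z ij by blast+
      then have "\<phi> U V = U" by (auto simp: \<phi>_def)
      then show ?thesis using 5 by (simp add: linked_family_def)
    qed
  qed
  have inner: "term_over F ?S' (\<lambda>g. t (\<lambda>V. g (\<phi> U V)))" if "U \<in> ?S" for U
    by (rule term_over_rename[OF tm, where h = "\<phi> U"]) (rule \<phi>[OF that])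
  have "term_over F ?S' t'" unfolding t'_def
    by (rule term_over_subst[OF tm, where s = "\<lambda>U g. t (\<lambda>V. g (\<phi> U V))"]) (rule inner)
  moreover have "t' (\<lambda>U. if r \<in> U then y else x) = x" if xy: "x \<in> B" "y \<in> B" for r x y
  proof -
    define q where "q = (if r = j then t (\<lambda>V. if V = {j} then y else x)
      else if r = i then t (\<lambda>V. if V \<noteq> {j} then y else x) else y)"
    have "q \<in> B" unfolding q_def using xy by (auto intro!: term_over_closed[OF B(1) tm])
    have "t (\<lambda>V. if r \<in> \<phi> U V then y else x) = (if r \<in> U then q else x)" if U: "U \<in> ?S" for U
    proof -
      have ij: "i \<in> P" "i \<noteq> j" "i' \<noteq> j" using I i' j by auto
      have idem: "t (\<lambda>V. x) = x" "t (\<lambda>V. y) = y" using term_over_idem[OF B(2) tm] xy by auto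
      consider "U = {j}" | "U = {i}" | "U \<noteq> {j}" "U \<noteq> {i}" by blast
      then show ?thesis
      proof cases
        case 1
        show ?thesis
        proof (cases "r = j")
          case True
          then have "r \<in> \<phi> U V \<longleftrightarrow> V = {j}" for V using 1 by (auto simp: \<phi>_def)
          then show ?thesis using 1 True by (simp add: q_def)
        next
          case False
          then have "r \<in> \<phi> U V \<longleftrightarrow> r \<in> V" for V using 1 by (auto simp: \<phi>_def)
          then show ?thesis using 1 False row_t xy by simp
        qed
      next
        case 2
        consider "r = i" | "r = i'" | "r \<noteq> i" "r \<noteq> i'" by blast
        then show ?thesis
        proof cases
          case 1
          then have "r \<in> \<phi> U V \<longleftrightarrow> V \<noteq> {j}" for V using 2 i' ij by (auto simp: \<phi>_def)
          then show ?thesis using 1 2 ij by (simp add: q_def)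
        next
          case r: 2
          then have "r \<in> \<phi> U V \<longleftrightarrow> j \<in> V" for V using 2 i' ij by (auto simp: \<phi>_def)
          then show ?thesis using r 2 i' row_t xy by simp
        next
          case 3
          then have "r \<notin> \<phi> U V" for V using 2 ij by (auto simp: \<phi>_def)
          then show ?thesis using 2 3 idem by simp
        qed
      next
        case 3
        consider "r \<notin> U" | "r \<in> U" "r = i" | "r \<in> U" "r = j" | "r \<in> U" "r \<noteq> i" "r \<noteq> j" by blast
        then show ?thesis
        proof cases
          case 1
          then have "r \<notin> \<phi> U V" for V using 3 by (auto simp: \<phi>_def)
          then show ?thesis using 1 idem by simp
        next
          case 2
          then have "r \<in> \<phi> U V \<longleftrightarrow> V \<noteq> {j}" for V using 3 ij by (auto simp: \<phi>_def)
          then show ?thesis using 2 ij by (simp add: q_def)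
        next
          case r: 3
          then have "r \<in> \<phi> U V \<longleftrightarrow> V = {j}" for V using 3 ij by (auto simp: \<phi>_def)
          then show ?thesis using r ij by (simp add: q_def)
        next
          case 4
          then have "r \<in> \<phi> U V" for V using 3 by (auto simp: \<phi>_def)
          then show ?thesis using 4 idem by (simp add: q_def)
        qed
      qed
    qed
    \<comment> \<open>After the inner evaluation, row \<open>r\<close> is again a row of the matrix
      of \<open>t\<close>, now for the pair \<open>(x, q)\<close>.\<close>
    then have "t' (\<lambda>U. if r \<in> U then y else x) = t (\<lambda>U. if r \<in> U then q else x)"
      unfolding t'_def by (rule term_over_cong[OF tm])
    also have "\<dots> = x" using row_t xy \<open>q \<in> B\<close> by simp
    finally show ?thesis .
  qed
  ultimately show "family_op B F ?S' t'" by (simp add: family_op_def)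
qed

text \<open>The rows of \<open>I\<close> are unlinked one by one; two distinct elements of
  \<open>P\<close> always leave an \<open>i'\<close> different from \<open>i\<close>.\<close>

lemma family_op_unlink_all:
  assumes B: "algebra B F" "idempotent B F" and "finite I"
    and t: "family_op B F (linked_family P j I Z) t"
    and "I \<subseteq> P" and P: "p \<in> P" "p' \<in> P" "p \<noteq> p'" and "j \<notin> P"
    and Z: "\<And>U. U \<in> Z \<Longrightarrow> U \<inter> insert j P = {}" "{} \<notin> Z"
  shows "\<exists>t'. family_op B F (linked_family P j {} Z) t'"
  using assms(3-5)
proof (induction I arbitrary: t)
  case (insert i I)
  obtain i' where i': "i' \<in> P" "i' \<noteq> i" using P by metis
  have "\<exists>t'. family_op B F (linked_family P j (insert i I - {i}) Z) t'"
    by (rule family_op_unlink[OF B insert(4,5) insertI1 i' \<open>j \<notin> P\<close> Z])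
  then obtain t' where "family_op B F (linked_family P j (insert i I - {i}) Z) t'" ..
  then show ?case using insert by (metis Diff_insert_absorb insert_subset)
qed blast

text \<open>These families lead from a cube term (\<open>j = k\<close>) to an edge term: for
  \<open>j = 2\<close> and \<open>k \<ge> 3\<close> the columns are \<open>{1}\<close>,
  \<open>{2}\<close>, \<open>{1, 2}\<close>, \<open>{3}\<close>, ..., \<open>{k}\<close>.\<close>

definition edge_family :: "nat \<Rightarrow> nat \<Rightarrow> nat set set" where
  "edge_family j k = (Pow {1..j} - {{}}) \<union> (\<lambda>l. {l}) ` {j<..k}"

lemma family_op_edge:
  assumes B: "algebra B F" "idempotent B F" and c: "has_cube_term B F"
  shows "\<exists>k\<ge>3. \<exists>t. family_op B F (edge_family 2 k) t"
proof -
  obtain k0 t0 where t0: "family_op B F (Pow {1..k0} - {{}}) t0"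
    using has_cube_term_imp_family_op[OF assms] by blast
  \<comment> \<open>Enlarging \<open>k0\<close> to at least 3 is harmless, since it only adds
    columns.\<close>
  define k where "k = max 3 k0"
  have top: "family_op B F (edge_family k k) t0"
    by (rule family_op_mono[OF t0]) (auto simp: edge_family_def k_def)
  have unlink: "\<exists>t'. family_op B F (edge_family j k) t'"
    if "family_op B F (edge_family (Suc j) k) t" "j \<ge> 2" "Suc j \<le> k" for j t
  proof -
    let ?Z = "(\<lambda>l. {l}) ` {Suc j<..k}"
    have Suc_j: "{1..Suc j} = insert (Suc j) {1..j}" by auto
    \<comment> \<open>At first the row \<open>Suc j\<close> is linked to every row in
      \<open>{1..j}\<close>.\<close>
    have "edge_family (Suc j) k = linked_family {1..j} (Suc j) {1..j} ?Z"
      unfolding edge_family_def linked_family_def Suc_j Pow_insert by auto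
    moreover have "linked_family {1..j} (Suc j) {} ?Z = edge_family j k"
    proof -
      have "{j<..k} = insert (Suc j) {Suc j<..k}" using that by auto
      then show ?thesis unfolding edge_family_def linked_family_def by auto
    qed
    moreover have Z: "U \<inter> insert (Suc j) {1..j} = {}" if "U \<in> ?Z" for U using that by auto
    moreover have "{} \<notin> ?Z" by blast
    ultimately show ?thesis
      using family_op_unlink_all[OF B, of "{1..j}" "{1..j}" "Suc j" ?Z t 1 2] that by simp
  qed
  have down: "\<exists>t'. family_op B F (edge_family 2 k) t'"
    if "family_op B F (edge_family j k) t" "2 \<le> j" "j \<le> k" for j t
    using that(2,1,3)
  proof (induction j arbitrary: t rule: dec_induct)
    case (step j)
    then show ?case using unlink by (metis Suc_leD)
  qed blast
  have "k \<ge> 3" by (simp add: k_def)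
  then show ?thesis using down[OF top] by auto
qed

subsection \<open>Forks\<close>

definition edge_column :: "'c \<Rightarrow> 'c \<Rightarrow> 'c \<Rightarrow> (nat \<Rightarrow> 'c) \<Rightarrow> nat set \<Rightarrow> 'c" where
  "edge_column a b c d U =
     (if U = {1} then a else if U = {2} then b else if U = {1, 2} then c else d (the_elem U))"

lemma edge_family_cases:
  assumes "U \<in> edge_family 2 k"
  obtains "U = {1}" | "U = {2}" | "U = {1, 2}" | l where "U = {l}" "l \<in> {3..k}"
proof -
  have "{1..2::nat} = {1, 2}" by auto
  then have "edge_family 2 k = {{1}, {2}, {1, 2}} \<union> (\<lambda>l. {l}) ` {3..k}"
    unfolding edge_family_def by (auto simp: Pow_insert)
  with assms that show thesis by blast
qed

lemma edge_column_simps [simp]: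
  "edge_column a b c d {Suc 0} = a" "edge_column a b c d {2} = b"
  "edge_column a b c d {Suc 0, 2} = c"
  "l \<ge> 3 \<Longrightarrow> edge_column a b c d {l} = d l"
proof -
  show "edge_column a b c d {Suc 0, 2} = c"
    using doubleton_eq_iff[of "1 :: nat" 2] by (simp add: edge_column_def)
  show "edge_column a b c d {l} = d l" if "l \<ge> 3"
    using that doubleton_eq_iff[of l l 1 2] by (simp add: edge_column_def)
qed (simp_all add: edge_column_def)

locale edge_op =
  fixes B :: "'b set" and F :: "('b, 'b) finitary set" and k :: nat and e :: "(nat set \<Rightarrow> 'b) \<Rightarrow> 'b"
  assumes algebra: "algebra B F" and idem: "idempotent B F" and k3: "k \<ge> 3"
    and edge: "family_op B F (edge_family 2 k) e"
begin

lemma tm_e: "term_over F (edge_family 2 k) e"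
  using edge by (simp add: family_op_def)

lemma e_row:
  assumes "x \<in> B" "y \<in> B" "\<And>U. U \<in> edge_family 2 k \<Longrightarrow> g U = (if r \<in> U then y else x)"
  shows "e g = x"
proof -
  have "e g = e (\<lambda>U. if r \<in> U then y else x)" by (rule term_over_cong[OF tm_e]) (rule assms(3))
  then show ?thesis using edge assms(1,2) by (simp add: family_op_def)
qed

lemma e_row1:
  assumes "x \<in> B" "y \<in> B" "\<And>l. l \<in> {3..k} \<Longrightarrow> d l = x"
  shows "e (edge_column y x y d) = x"
proof (rule e_row[OF assms(1,2), where r = 1])
  fix U assume "U \<in> edge_family 2 k"
  then show "edge_column y x y d U = (if 1 \<in> U then y else x)"
    by (cases rule: edge_family_cases) (use assms(3) in auto)
qed

lemma e_row2:
  assumes "x \<in> B" "y \<in> B" "\<And>l. l \<in> {3..k} \<Longrightarrow> d l = x"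
  shows "e (edge_column x y y d) = x"
proof (rule e_row[OF assms(1,2), where r = 2])
  fix U assume "U \<in> edge_family 2 k"
  then show "edge_column x y y d U = (if 2 \<in> U then y else x)"
    by (cases rule: edge_family_cases) (use assms(3) in auto)
qed

lemma e_single:
  assumes "x \<in> B" "d i \<in> B" "i \<in> {3..k}" "\<And>l. l \<in> {3..k} \<Longrightarrow> l \<noteq> i \<Longrightarrow> d l = x"
  shows "e (edge_column x x x d) = x"
proof (rule e_row[OF assms(1,2), where r = i])
  fix U assume "U \<in> edge_family 2 k"
  then show "edge_column x x x d U = (if i \<in> U then d i else x)"
    by (cases rule: edge_family_cases) (use assms(3,4) in auto)
qed

lemma edge_combination:
  assumes "subalgebra_of_power X B F R" "a \<in> R" "b \<in> R" "c \<in> R" "\<And>l. l \<in> {3..k} \<Longrightarrow> d l \<in> R"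
  shows "(\<lambda>x\<in>X. e (edge_column (a x) (b x) (c x) (\<lambda>l. d l x))) \<in> R"
proof -
  have "edge_column a b c d U \<in> R" if "U \<in> edge_family 2 k" for U
    using that by (cases rule: edge_family_cases) (use assms in auto)
  from term_over_subpower[OF assms(1) tm_e this]
  have "(\<lambda>x\<in>X. e (\<lambda>U. edge_column a b c d U x)) \<in> R" .
  moreover have "(\<lambda>U. edge_column a b c d U x) = edge_column (a x) (b x) (c x) (\<lambda>l. d l x)" for x
    by (auto simp: edge_column_def)
  ultimately show ?thesis by simp
qed

text \<open>
  The parallelogram property.  The tuples \<open>p\<close> and \<open>q\<close> combine \<open>v\<close> and \<open>u\<close> with the \<open>\<rho> l\<close>: on \<open>J\<close>
  they agree with each other, and with \<open>s\<close> outside \<open>y ` {3..k}\<close>.  As the \<open>\<rho>' l\<close> differ from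
  \<open>s\<close> only in other coordinates, the edge identities apply to \<open>p\<close>, \<open>z\<close>, \<open>q\<close> and the \<open>\<rho>' l\<close>.
\<close>
lemma parallelogram:
  assumes R: "subalgebra_of_power X B F R" and J: "J \<subseteq> X" "m \<in> X" "m \<notin> J"
    and s: "\<And>x. x \<in> X \<Longrightarrow> s x \<in> B"
    and r0: "r0 \<in> R" "\<And>x. x \<in> J \<Longrightarrow> r0 x = s x"
    and uv: "u \<in> R" "v \<in> R" "\<And>x. x \<in> J \<Longrightarrow> u x = v x" "u m = r0 m" "v m = s m"
    and \<rho>: "\<And>l. l \<in> {3..k} \<Longrightarrow> \<rho> l \<in> R"
      "\<And>l x. l \<in> {3..k} \<Longrightarrow> x \<in> insert m J \<Longrightarrow> x \<noteq> y l \<Longrightarrow> \<rho> l x = s x"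
    and \<rho>': "\<And>l. l \<in> {3..k} \<Longrightarrow> \<rho>' l \<in> R"
      "\<And>l x. l \<in> {3..k} \<Longrightarrow> x \<in> insert m J \<Longrightarrow> x \<noteq> y' l \<Longrightarrow> \<rho>' l x = s x"
    and y: "inj_on y {3..k}" "inj_on y' {3..k}" "y ` {3..k} \<inter> y' ` {3..k} = {}"
      "y ` {3..k} \<subseteq> J" "y' ` {3..k} \<subseteq> J"
  shows "\<exists>r\<in>R. \<forall>x\<in>insert m J. r x = s x"
proof -
  define p where "p = (\<lambda>x\<in>X. e (edge_column (v x) (r0 x) (u x) (\<lambda>l. \<rho> l x)))"
  define q where "q = (\<lambda>x\<in>X. e (edge_column (u x) (r0 x) (u x) (\<lambda>l. \<rho> l x)))"
  define z where "z = (\<lambda>x\<in>X. e (edge_column (r0 x) (r0 x) (r0 x) (\<lambda>l. \<rho> l x)))"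
  define r where "r = (\<lambda>x\<in>X. e (edge_column (p x) (z x) (q x) (\<lambda>l. \<rho>' l x)))"
  have pqz: "p \<in> R" "q \<in> R" "z \<in> R"
    unfolding p_def q_def z_def using r0 uv \<rho> by (auto intro!: edge_combination[OF R])
  then have "r \<in> R" unfolding r_def using \<rho>' by (intro edge_combination[OF R])
  moreover have "r x = s x" if x: "x \<in> insert m J" for x
  proof -
    have "x \<in> X" "s x \<in> B" using x J s by auto
    have RB: "f x \<in> B" if "f \<in> R" for f
      using R that \<open>x \<in> X\<close> by (auto simp: subalgebra_of_power_def)
    have rx: "r x = e (edge_column (p x) (z x) (q x) (\<lambda>l. \<rho>' l x))"
      and px: "p x = e (edge_column (v x) (r0 x) (u x) (\<lambda>l. \<rho> l x))"
      and qx: "q x = e (edge_column (u x) (r0 x) (u x) (\<lambda>l. \<rho> l x))"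
      and zx: "z x = e (edge_column (r0 x) (r0 x) (r0 x) (\<lambda>l. \<rho> l x))"
      using \<open>x \<in> X\<close> by (simp_all add: r_def p_def q_def z_def)
    consider "x = m" | "x \<in> J" "x \<notin> y ` {3..k}" "x \<notin> y' ` {3..k}"
      | i where "x \<in> J" "i \<in> {3..k}" "x = y i" | i where "x \<in> J" "i \<in> {3..k}" "x = y' i"
      using x by blast
    then show ?thesis
    proof cases
      case 1
      then have "x \<notin> y ` {3..k}" "x \<notin> y' ` {3..k}" using y(4,5) J(3) by blast+
      then have \<rho>s: "\<rho> l x = s x" "\<rho>' l x = s x" if l: "l \<in> {3..k}" for l
        using \<rho>(2)[OF l x] \<rho>'(2)[OF l x] l by blast+
      have "p x = s x"
        unfolding px using 1 uv e_row2[OF \<open>s x \<in> B\<close> RB[OF r0(1)] \<rho>s(1)] by simp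
      moreover have "q x = z x" unfolding qx zx using 1 uv by simp
      ultimately show ?thesis
        unfolding rx using e_row2[OF \<open>s x \<in> B\<close> RB[OF pqz(3)] \<rho>s(2)] by simp
    next
      case 2
      then have \<rho>s: "\<rho> l x = s x" "\<rho>' l x = s x" if l: "l \<in> {3..k}" for l
        using \<rho>(2)[OF l x] \<rho>'(2)[OF l x] l by blast+
      have "p x = s x" "q x = s x"
        unfolding px qx using 2 r0 uv e_row1[OF \<open>s x \<in> B\<close> RB[OF uv(1)] \<rho>s(1)] by simp_all
      moreover have "z x = s x"
        unfolding zx using 2 r0 e_row1[OF \<open>s x \<in> B\<close> \<open>s x \<in> B\<close> \<rho>s(1)] by simp
      ultimately show ?thesis
        unfolding rx using e_row1[OF \<open>s x \<in> B\<close> \<open>s x \<in> B\<close> \<rho>s(2)] by simp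
    next
      case (3 i)
      then have "x \<notin> y' ` {3..k}" using y(3) by blast
      then have \<rho>s: "\<rho>' l x = s x" if l: "l \<in> {3..k}" for l
        using \<rho>'(2)[OF l x] l by blast
      have "p x = q x" unfolding px qx using 3 uv by simp
      moreover have "z x = s x"
      proof -
        have "\<rho> l x = s x" if "l \<in> {3..k}" "l \<noteq> i" for l
          using \<rho>(2)[OF that(1) x] 3 that inj_onD[OF y(1), of l i] by metis
        then show ?thesis
          unfolding zx using e_single[OF \<open>s x \<in> B\<close>, of "\<lambda>l. \<rho> l x" i] RB[OF \<rho>(1)] 3 r0 by simp
      qed
      ultimately show ?thesis
        unfolding rx using e_row1[OF \<open>s x \<in> B\<close> RB[OF pqz(2)] \<rho>s] by simp
    next
      case (4 i)
      then have "x \<notin> y ` {3..k}" using y(3) by blast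
      then have \<rho>s: "\<rho> l x = s x" if l: "l \<in> {3..k}" for l
        using \<rho>(2)[OF l x] l by blast
      have "p x = s x" "q x = s x"
        unfolding px qx using 4 r0 uv e_row1[OF \<open>s x \<in> B\<close> RB[OF uv(1)] \<rho>s] by simp_all
      moreover have "z x = s x"
        unfolding zx using 4 r0 e_row1[OF \<open>s x \<in> B\<close> \<open>s x \<in> B\<close> \<rho>s] by simp
      moreover have "\<rho>' l x = s x" if "l \<in> {3..k}" "l \<noteq> i" for l
        using \<rho>'(2)[OF that(1) x] 4 that inj_onD[OF y(2), of l i] by metis
      ultimately show ?thesis
        unfolding rx using e_single[OF \<open>s x \<in> B\<close>, of "\<lambda>l. \<rho>' l x" i] RB[OF \<rho>'(1)] 4 by simp
    qed
  qed
  ultimately show ?thesis by blast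
qed

text \<open>If \<open>J\<close> is small, the hypothesis on small projections suffices. Otherwise
  the induction hypothesis for \<open>J\<close> without one point, used for
  \<open>2 * (k - 2)\<close> points, supplies the data for \<open>parallelogram\<close>.\<close>

lemma extend_agreement:
  assumes R: "subalgebra_of_power X B F R" and s: "\<And>x. x \<in> X \<Longrightarrow> s x \<in> B"
    and m: "m \<in> X" and J: "finite J" "J \<subseteq> X" "m \<notin> J"
    and r0: "r0 \<in> R" "\<And>x. x \<in> J \<Longrightarrow> r0 x = s x"
    and uv: "u \<in> R" "v \<in> R" "\<And>x. x \<in> J \<Longrightarrow> u x = v x" "u m = r0 m" "v m = s m"
    and small: "\<And>J'. J' \<subseteq> X \<Longrightarrow> card J' \<le> 2 * k \<Longrightarrow> \<exists>r\<in>R. \<forall>x\<in>J'. r x = s x"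
  shows "\<exists>r\<in>R. \<forall>x\<in>insert m J. r x = s x"
  using J r0(2) uv(3)
proof (induction "card J" arbitrary: J rule: less_induct)
  case less
  \<comment> \<open>Indices of the removed points: first component 0 for \<open>y\<close> and 1 for
    \<open>y'\<close>.\<close>
  let ?L = "{0, 1::nat} \<times> {3..k}"
  have card_L: "card ?L = 2 * (k - 2)" using k3 by (simp add: card_cartesian_product)
  show ?case
  proof (cases "card J < card ?L")
    case True
    then have "card (insert m J) \<le> 2 * k" using card_L k3 card_insert_le_m1[of "2 * k" J m] by simp
    then show ?thesis using small[of "insert m J"] less.prems m by simp
  next
    case False
    then obtain T where T: "T \<subseteq> J" "card T = card ?L"
      by (meson obtain_subset_with_card_n not_less)
    have "finite T" using T(1) less.prems(1) finite_subset by blast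
    then have "\<exists>h. bij_betw h ?L T" by (intro finite_same_card_bij) (simp_all add: T(2))
    then obtain h where h: "bij_betw h ?L T" ..
    have hJ: "h l \<in> J" if "l \<in> ?L" for l using bij_betwE[OF h] T(1) that by blast
    have h_inj: "h l = h l' \<longleftrightarrow> l = l'" if "l \<in> ?L" "l' \<in> ?L" for l l'
      using h that by (auto simp: bij_betw_def inj_on_def)
    have "\<exists>r\<in>R. \<forall>x\<in>insert m (J - {h l}). r x = s x" if l: "l \<in> ?L" for l
    proof (rule less.hyps)
      show "card (J - {h l}) < card J" using hJ[OF l] less.prems(1) by (rule card_Diff1_less[rotated])
    qed (use less.prems in auto)
    then obtain \<rho> where \<rho>: "\<And>l. l \<in> ?L \<Longrightarrow> \<rho> l \<in> R \<and> (\<forall>x\<in>insert m (J - {h l}). \<rho> l x = s x)"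
      by metis
    show ?thesis
    proof (rule parallelogram[OF R less.prems(2) m less.prems(3) s r0(1) less.prems(4) uv(1,2)
          less.prems(5) uv(4,5), where \<rho> = "\<lambda>l. \<rho> (0, l)" and \<rho>' = "\<lambda>l. \<rho> (1, l)"
          and y = "\<lambda>l. h (0, l)" and y' = "\<lambda>l. h (1, l)"])
      show "inj_on (\<lambda>l. h (0, l)) {3..k}" "inj_on (\<lambda>l. h (1, l)) {3..k}"
        using h_inj by (auto intro!: inj_onI)
      show "(\<lambda>l. h (0, l)) ` {3..k} \<inter> (\<lambda>l. h (1, l)) ` {3..k} = {}"
        using h_inj by fastforce
      show "(\<lambda>l. h (0, l)) ` {3..k} \<subseteq> J" "(\<lambda>l. h (1, l)) ` {3..k} \<subseteq> J"
        using hJ by auto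
    qed (use \<rho> in auto)
  qed
qed

text \<open>A given \<open>s \<in> S\<close> is matched by members of \<open>R\<close> on growing
  initial segments of the order; the forks provide \<open>u\<close> and \<open>v\<close> for adding
  the next point.\<close>

lemma subpower_eqI:
  assumes R: "subalgebra_of_power X B F R" and S: "S \<subseteq> X \<rightarrow>\<^sub>E B" "R \<subseteq> S" and X: "finite X"
    and order: "\<And>x. \<not> lt x x" "\<And>x y z. lt x y \<Longrightarrow> lt y z \<Longrightarrow> lt x z"
      "\<And>x y. x \<in> X \<Longrightarrow> y \<in> X \<Longrightarrow> x \<noteq> y \<Longrightarrow> lt x y \<or> lt y x"
    and small: "\<And>s J. s \<in> S \<Longrightarrow> J \<subseteq> X \<Longrightarrow> card J \<le> 2 * k \<Longrightarrow> \<exists>r\<in>R. \<forall>x\<in>J. r x = s x"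
    and forks: "\<And>m f g. m \<in> X \<Longrightarrow> f \<in> S \<Longrightarrow> g \<in> S \<Longrightarrow> (\<And>x. x \<in> X \<Longrightarrow> lt x m \<Longrightarrow> f x = g x) \<Longrightarrow>
      \<exists>u\<in>R. \<exists>v\<in>R. (\<forall>x\<in>X. lt x m \<longrightarrow> u x = v x) \<and> u m = f m \<and> v m = g m"
  shows "S = R"
proof
  show "S \<subseteq> R"
  proof
    fix s assume s: "s \<in> S"
    have sB: "s x \<in> B" if "x \<in> X" for x using S s that by blast
    have "\<exists>r\<in>R. \<forall>x\<in>D. r x = s x"
      if "D \<subseteq> X" "\<And>x y. y \<in> D \<Longrightarrow> x \<in> X \<Longrightarrow> lt x y \<Longrightarrow> x \<in> D" for D
      using finite_subset[OF that(1) X] that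
    proof (induction "card D" arbitrary: D rule: less_induct)
      case less
      show ?case
      proof (cases "D = {}")
        case True
        then show ?thesis using small[OF s, of "{}"] by simp
      next
        case False
        have "\<exists>m\<in>D. \<forall>x\<in>D. x \<noteq> m \<longrightarrow> \<not> lt m x"
        proof (rule Finite_Set.bex_max_element)
          show "asymp_on D lt" by (rule asymp_onI) (metis order(1,2))
          show "transp_on D lt" by (rule transp_onI) (rule order(2))
        qed (use less.prems(1) False in simp_all)
        then obtain m where m: "m \<in> D" "\<forall>x\<in>D. \<not> lt m x" using order(1) by metis
        \<comment> \<open>As \<open>D\<close> is an initial segment of a linear order with maximum
          \<open>m\<close>, exactly the elements below \<open>m\<close> remain.\<close>
        have D: "x \<in> D - {m} \<longleftrightarrow> x \<in> X \<and> lt x m" for x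
          using m less.prems(2) less.prems(3)[OF m(1), of x] order(1)[of m] order(3)[of x m] by auto
        have "card (D - {m}) < card D" using m(1) less.prems(1) by (rule card_Diff1_less[rotated])
        moreover have "x \<in> D - {m}" if "y \<in> D - {m}" "x \<in> X" "lt x y" for x y
          using that(1,2) order(2)[OF that(3)] unfolding D by blast
        moreover have "finite (D - {m})" "D - {m} \<subseteq> X" using less.prems(1,2) by auto
        ultimately have "\<exists>r\<in>R. \<forall>x\<in>D - {m}. r x = s x" by (intro less.hyps)
        then obtain r0 where r0: "r0 \<in> R" "\<forall>x\<in>D - {m}. r0 x = s x" by blast
        have mX: "m \<in> X" using m less.prems(2) by blast
        have "r0 x = s x" if "x \<in> X" "lt x m" for x using r0(2) that D by simp
        \<comment> \<open>\<open>r0\<close> and \<open>s\<close> agree below \<open>m\<close>, so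
          they form a fork of \<open>S\<close>; \<open>u\<close> and \<open>v\<close> realise it in
          \<open>R\<close>.\<close>
        from forks[OF mX _ s this] r0(1) S(2)
        obtain u v where uv: "u \<in> R" "v \<in> R" "\<forall>x\<in>X. lt x m \<longrightarrow> u x = v x" "u m = r0 m" "v m = s m"
          by blast
        have "\<exists>r\<in>R. \<forall>x\<in>insert m (D - {m}). r x = s x"
        proof (rule extend_agreement[where m = m and s = s and ?r0.0 = r0 and u = u and v = v, OF R])
          show "\<exists>r\<in>R. \<forall>x\<in>J. r x = s x" if "J \<subseteq> X" "card J \<le> 2 * k" for J
            using small[OF s that] .
          show "s x \<in> B" if "x \<in> X" for x using sB[OF that] .
          show "u x = v x" if "x \<in> D - {m}" for x using uv(3) that unfolding D by blast
          show "r0 x = s x" if "x \<in> D - {m}" for x using r0(2) that by blast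
          show "D - {m} \<subseteq> X" using less.prems(2) by blast
        qed (use less.prems(1) r0(1) uv mX in simp_all)
        then show ?thesis using m(1) by (simp add: insert_absorb)
      qed
    qed
    from this[of X] obtain r where r: "r \<in> R" "\<forall>x\<in>X. r x = s x" by blast
    have "r = s" by (rule PiE_ext[of r X "\<lambda>_. B" s]) (use r s S in auto)
    then show "s \<in> R" using r by simp
  qed
qed (rule S(2))

end

subsection \<open>Higman's lemma\<close>

text \<open>Well-quasi-ordering in the form of infinite ascending subsequences, which can be
  extracted successively for several components of a word.\<close>

definition has_chains :: "'a list set \<Rightarrow> bool" where
  "has_chains S \<longleftrightarrow> (\<forall>f :: nat \<Rightarrow> 'a list. range f \<subseteq> S \<longrightarrow>
     (\<exists>\<phi> :: nat \<Rightarrow> nat. strict_mono \<phi> \<and> (\<forall>i j. i \<le> j \<longrightarrow> subseq (f (\<phi> i)) (f (\<phi> j)))))"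

lemma has_chainsD:
  assumes "has_chains S" "range (f :: nat \<Rightarrow> 'a list) \<subseteq> S"
  obtains \<phi> :: "nat \<Rightarrow> nat" where "strict_mono \<phi>" "\<And>i j. i \<le> j \<Longrightarrow> subseq (f (\<phi> i)) (f (\<phi> j))"
  using assms unfolding has_chains_def by metis

lemma infinite_nat_subsequence:
  fixes M :: "nat set"
  assumes "infinite M"
  obtains \<phi> :: "nat \<Rightarrow> nat" where "strict_mono \<phi>" "\<And>n. \<phi> n \<in> M"
  using infinite_enumerate[OF assms] by blast

text \<open>A word avoiding \<open>a # u\<close> either lacks \<open>a\<close> or splits at its
  first \<open>a\<close> into a prefix over the smaller alphabet and a suffix avoiding
  \<open>u\<close>.\<close>

lemma has_chains_avoiding:
  assumes smaller: "\<And>a. a \<in> \<Sigma> \<Longrightarrow> has_chains (lists (\<Sigma> - {a}))"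
  shows "u \<in> lists \<Sigma> \<Longrightarrow> has_chains {w \<in> lists \<Sigma>. \<not> subseq u w}"
proof (induction u)
  case Nil
  then show ?case by (simp add: has_chains_def)
next
  case (Cons a u)
  show ?case unfolding has_chains_def
  proof (intro allI impI)
    fix f :: "nat \<Rightarrow> 'a list"
    assume "range f \<subseteq> {w \<in> lists \<Sigma>. \<not> subseq (a # u) w}"
    then have f: "set (f i) \<subseteq> \<Sigma>" "\<not> subseq (a # u) (f i)" for i by auto
    define v where "v i = takeWhile (\<lambda>c. c \<noteq> a) (f i)" for i
    define r where "r i = dropWhile (\<lambda>c. c \<noteq> a) (f i)" for i
    have fvr: "f i = v i @ r i" for i by (simp add: v_def r_def)
    have "range v \<subseteq> lists (\<Sigma> - {a})"
      using f(1) by (auto simp: v_def dest: set_takeWhileD)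
    then obtain \<phi>1 :: "nat \<Rightarrow> nat" where \<phi>1: "strict_mono \<phi>1" "\<And>i j. i \<le> j \<Longrightarrow> subseq (v (\<phi>1 i)) (v (\<phi>1 j))"
      using has_chainsD[OF smaller[of a]] Cons.prems by (metis listsE)
    show "\<exists>\<phi> :: nat \<Rightarrow> nat. strict_mono \<phi> \<and> (\<forall>i j. i \<le> j \<longrightarrow> subseq (f (\<phi> i)) (f (\<phi> j)))"
    \<comment> \<open>\<open>r\<close> is empty exactly for the words without the letter
      \<open>a\<close>.\<close>
    proof (cases "infinite {i. r (\<phi>1 i) = []}")
      case True
      then obtain \<phi>2 :: "nat \<Rightarrow> nat" where \<phi>2: "strict_mono \<phi>2" "\<And>n. \<phi>2 n \<in> {i. r (\<phi>1 i) = []}"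
        using infinite_nat_subsequence by blast
      have "subseq (f (\<phi>1 (\<phi>2 i))) (f (\<phi>1 (\<phi>2 j)))" if "i \<le> j" for i j
        using \<phi>1(2)[of "\<phi>2 i" "\<phi>2 j"] \<phi>2 that by (simp add: fvr strict_mono_less_eq)
      then show ?thesis using strict_mono_o[OF \<phi>1(1) \<phi>2(1)] by (intro exI[of _ "\<phi>1 \<circ> \<phi>2"]) simp
    next
      case False
      then have "infinite {i. r (\<phi>1 i) \<noteq> []}"
        using Collect_neg_eq[of "\<lambda>i. r (\<phi>1 i) = []"] finite_Collect_not by blast
      then obtain \<phi>2 :: "nat \<Rightarrow> nat" where \<phi>2: "strict_mono \<phi>2" "\<And>n. \<phi>2 n \<in> {i. r (\<phi>1 i) \<noteq> []}"
        using infinite_nat_subsequence by blast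
      define g where "g i = tl (r (\<phi>1 (\<phi>2 i)))" for i
      have r: "r (\<phi>1 (\<phi>2 i)) = a # g i" for i
      proof -
        have "r (\<phi>1 (\<phi>2 i)) \<noteq> []" using \<phi>2(2) by blast
        then show ?thesis
          using hd_dropWhile[of "\<lambda>c. c \<noteq> a"] by (metis g_def list.collapse r_def)
      qed
      have "range g \<subseteq> {w \<in> lists \<Sigma>. \<not> subseq u w}"
      proof (intro subsetI, elim rangeE)
        fix w i assume w: "w = g i"
        have eq: "f (\<phi>1 (\<phi>2 i)) = v (\<phi>1 (\<phi>2 i)) @ a # w" using fvr r w by simp
        have "\<not> subseq u w"
        proof
          assume "subseq u w"
          then have "subseq (a # u) (f (\<phi>1 (\<phi>2 i)))"
            unfolding eq by (intro subseq_drop_many) simp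
          then show False using f(2) by blast
        qed
        then show "w \<in> {w \<in> lists \<Sigma>. \<not> subseq u w}"
          using f(1)[of "\<phi>1 (\<phi>2 i)"] unfolding eq by (simp add: in_lists_conv_set subset_iff)
      qed
      then obtain \<phi>3 :: "nat \<Rightarrow> nat" where \<phi>3: "strict_mono \<phi>3" "\<And>i j. i \<le> j \<Longrightarrow> subseq (g (\<phi>3 i)) (g (\<phi>3 j))"
        using Cons has_chainsD by (metis lists.cases list.inject list.distinct(1))
      have "subseq (f (\<phi>1 (\<phi>2 (\<phi>3 i)))) (f (\<phi>1 (\<phi>2 (\<phi>3 j))))" if "i \<le> j" for i j
      proof -
        have "\<phi>2 (\<phi>3 i) \<le> \<phi>2 (\<phi>3 j)"
          using that \<phi>2(1) \<phi>3(1) by (simp add: strict_mono_less_eq)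
        then show ?thesis
          unfolding fvr r using \<phi>1(2) \<phi>3(2)[OF that] by (intro list_emb_append_mono) simp_all
      qed
      then show ?thesis
        using strict_mono_o[OF \<phi>1(1) strict_mono_o[OF \<phi>2(1) \<phi>3(1)]]
        by (intro exI[of _ "\<phi>1 \<circ> (\<phi>2 \<circ> \<phi>3)"]) simp
    qed
  qed
qed

lemma higman_finite_alphabet:
  assumes "finite \<Sigma>"
  shows "has_chains (lists \<Sigma>)"
  using assms
proof (induction \<Sigma> rule: finite_psubset_induct)
  case (psubset \<Sigma>)
  have avoid: "has_chains {w \<in> lists \<Sigma>. \<not> subseq u w}" if "u \<in> lists \<Sigma>" for u
    by (rule has_chains_avoiding[OF _ that]) (rule psubset.IH, blast)
  show ?case unfolding has_chains_def
  proof (intro allI impI)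
    fix f :: "nat \<Rightarrow> 'a list" assume f: "range f \<subseteq> lists \<Sigma>"
    show "\<exists>\<phi> :: nat \<Rightarrow> nat. strict_mono \<phi> \<and> (\<forall>i j. i \<le> j \<longrightarrow> subseq (f (\<phi> i)) (f (\<phi> j)))"
    \<comment> \<open>Either infinitely many words avoid one fixed word of the sequence, or every
      word embeds into a later one and iteration gives a chain.\<close>
    proof (cases "\<exists>i. infinite {j. \<not> subseq (f i) (f j)}")
      case True
      then obtain i where "infinite {j. \<not> subseq (f i) (f j)}" ..
      then obtain r :: "nat \<Rightarrow> nat" where r: "strict_mono r" "\<And>n. r n \<in> {j. \<not> subseq (f i) (f j)}"
        using infinite_nat_subsequence by blast
      have range: "range (\<lambda>n. f (r n)) \<subseteq> {w \<in> lists \<Sigma>. \<not> subseq (f i) w}" using f r(2) by auto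
      have "f i \<in> lists \<Sigma>" using f by blast
      from has_chainsD[OF avoid[OF this] range] obtain \<phi> :: "nat \<Rightarrow> nat" where \<phi>:
        "strict_mono \<phi>" "\<And>i j. i \<le> j \<Longrightarrow> subseq (f (r (\<phi> i))) (f (r (\<phi> j)))"
        by blast
      then show ?thesis using strict_mono_o[OF r(1) \<phi>(1)] by (intro exI[of _ "r \<circ> \<phi>"]) simp
    next
      case False
      have "\<exists>m>n. subseq (f n) (f m)" for n
      proof -
        have "finite ({j. \<not> subseq (f n) (f j)} \<union> {..n})" using False by blast
        then obtain m where "m \<notin> {j. \<not> subseq (f n) (f j)} \<union> {..n}"
          by (metis ex_new_if_finite infinite_UNIV_nat)
        then show ?thesis by (intro exI[of _ m]) auto
      qed
      then obtain s where s: "\<And>n. s n > n" "\<And>n. subseq (f n) (f (s n))" by metis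
      define \<phi> where "\<phi> n = (s ^^ n) 0" for n
      have \<phi>_Suc: "\<phi> (Suc n) = s (\<phi> n)" for n by (simp add: \<phi>_def)
      have "strict_mono \<phi>" using s(1) by (simp add: strict_mono_Suc_iff \<phi>_Suc)
      moreover have "subseq (f (\<phi> i)) (f (\<phi> j))" if "i \<le> j" for i j
        using that
      proof (induction rule: dec_induct)
        case (step n)
        then show ?case using s(2)[of "\<phi> n"] \<phi>_Suc by (metis subseq_order.trans)
      qed simp
      ultimately show ?thesis by blast
    qed
  qed
qed

text \<open>
  Positions are counted from the end of the list, so that \<open>#\<close> appends a last letter.  \<open>mark\<close>
  records for every letter whether it occurs at an earlier position.
\<close>
fun mark :: "'a list \<Rightarrow> ('a \<times> bool) list" where
  "mark [] = []"
| "mark (a # xs) = (a, a \<in> set xs) # mark xs"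

definition letter :: "'a list \<Rightarrow> nat \<Rightarrow> 'a" where
  "letter xs i = xs ! (length xs - i)"

lemma letter_Cons_last: "letter (a # xs) (Suc (length xs)) = a"
  by (simp add: letter_def)

lemma letter_Cons: "i \<le> length xs \<Longrightarrow> letter (a # xs) i = letter xs i"
  by (simp add: letter_def Suc_diff_le)

lemma in_set_letter: "a \<in> set xs \<Longrightarrow> \<exists>j\<in>{1..length xs}. letter xs j = a"
proof -
  assume "a \<in> set xs"
  then obtain n where n: "n < length xs" "xs ! n = a" by (auto simp: in_set_conv_nth)
  then have "letter xs (length xs - n) = a" by (simp add: letter_def)
  then show ?thesis using n by (intro bexI[of _ "length xs - n"]) auto
qed

lemma map_fst_mark: "map fst (mark xs) = xs"
  by (induction xs) simp_all

text \<open>The second condition says that the fibres of \<open>\<sigma>\<close> are ordered by their first elements.\<close>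
definition collapses :: "(nat \<Rightarrow> nat) \<Rightarrow> nat \<Rightarrow> nat \<Rightarrow> bool" where
  "collapses \<sigma> n m \<longleftrightarrow> \<sigma> \<in> {1..n} \<rightarrow> {1..m} \<and>
     (\<forall>p\<in>{1..m}. \<exists>q\<in>{1..n}. \<sigma> q = p \<and> (\<forall>i\<in>{1..<q}. \<sigma> i < p))"

definition collapses_to :: "nat \<Rightarrow> (nat \<Rightarrow> 'a) \<Rightarrow> nat \<Rightarrow> (nat \<Rightarrow> 'a) \<Rightarrow> bool" where
  "collapses_to n w m v \<longleftrightarrow> (\<exists>\<sigma>. collapses \<sigma> n m \<and> w = (\<lambda>p\<in>{1..n}. v (\<sigma> p)))"

text \<open>Induction on the last letter \<open>b\<close> of \<open>ys\<close>. If it is unmatched,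
  its position goes to any occurrence of \<open>b\<close> in \<open>xs\<close>; if it is matched, it
  goes to the last position of \<open>xs\<close>. Both choices keep the first elements of the
  earlier fibres.\<close>

lemma subseq_mark_imp_collapses:
  assumes "subseq (mark xs) (mark ys)" "set xs = set ys"
  shows "\<exists>\<sigma>. collapses \<sigma> (length ys) (length xs) \<and> (\<forall>i\<in>{1..length ys}. letter ys i = letter xs (\<sigma> i))"
  using assms
proof (induction ys arbitrary: xs)
  case Nil
  then show ?case by (intro exI[of _ id]) (simp add: collapses_def)
next
  case (Cons b ys)
  let ?n = "length ys"
  consider "subseq (mark xs) (mark ys)" | zs where "mark xs = (b, b \<in> set ys) # zs" "subseq zs (mark ys)"
    using Cons.prems(1) by (cases rule: list_emb.cases) auto
  then show ?case
  proof cases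
    case 1
    have sub: "subseq xs ys" using subseq_map[OF 1, of fst] by (simp add: map_fst_mark)
    have "x \<in> set ys" if "x \<in> set xs" for x
      using list_emb_set[OF sub that] by metis
    then have "set xs = set ys" using Cons.prems(2) by auto
    from Cons.IH[OF 1 this] obtain \<sigma> where \<sigma>: "collapses \<sigma> ?n (length xs)"
      "\<forall>i\<in>{1..?n}. letter ys i = letter xs (\<sigma> i)" by blast
    have "b \<in> set xs" using Cons.prems(2) by simp
    then obtain j where j: "j \<in> {1..length xs}" "letter xs j = b" using in_set_letter by metis
    define \<sigma>' where "\<sigma>' = \<sigma>(Suc ?n := j)"
    have "collapses \<sigma>' (Suc ?n) (length xs)"
      unfolding collapses_def
    proof (intro conjI ballI)
      show "\<sigma>' \<in> {1..Suc ?n} \<rightarrow> {1..length xs}"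
        using \<sigma>(1) j(1) by (auto simp: \<sigma>'_def collapses_def Pi_iff le_Suc_eq)
      fix p assume "p \<in> {1..length xs}"
      then obtain q where "q \<in> {1..?n}" "\<sigma> q = p" "\<forall>i\<in>{1..<q}. \<sigma> i < p"
        using \<sigma>(1) unfolding collapses_def by blast
      then show "\<exists>q\<in>{1..Suc ?n}. \<sigma>' q = p \<and> (\<forall>i\<in>{1..<q}. \<sigma>' i < p)"
        by (intro bexI[of _ q]) (auto simp: \<sigma>'_def)
    qed
    moreover have "letter (b # ys) i = letter xs (\<sigma>' i)" if "i \<in> {1..Suc ?n}" for i
      using that \<sigma>(2) j(2) by (cases "i = Suc ?n") (auto simp: \<sigma>'_def letter_Cons_last letter_Cons)
    ultimately show ?thesis by (intro exI[of _ \<sigma>']) simp_all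
  next
    case (2 zs)
    \<comment> \<open>Equal marks are what makes equality of the letter sets pass to the shorter
      words.\<close>
    then obtain xs' where xs: "xs = b # xs'" "(b \<in> set xs') = (b \<in> set ys)" "subseq (mark xs') (mark ys)"
      by (cases xs) auto
    then have "set xs' = set ys" using Cons.prems(2) by (auto simp: set_eq_iff)
    from Cons.IH[OF xs(3) this] obtain \<sigma> where \<sigma>: "collapses \<sigma> ?n (length xs')"
      "\<forall>i\<in>{1..?n}. letter ys i = letter xs' (\<sigma> i)" by blast
    let ?m = "length xs'"
    define \<sigma>' where "\<sigma>' = \<sigma>(Suc ?n := Suc ?m)"
    have range: "\<sigma> i \<in> {1..?m}" if "i \<in> {1..?n}" for i
      using \<sigma>(1) that by (auto simp: collapses_def)
    have "collapses \<sigma>' (Suc ?n) (Suc ?m)"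
      unfolding collapses_def
    proof (intro conjI ballI)
      show "\<sigma>' \<in> {1..Suc ?n} \<rightarrow> {1..Suc ?m}"
      proof
        fix i assume "i \<in> {1..Suc ?n}"
        then show "\<sigma>' i \<in> {1..Suc ?m}"
          using range[of i] by (cases "i = Suc ?n") (auto simp: \<sigma>'_def)
      qed
      fix p assume p: "p \<in> {1..Suc ?m}"
      show "\<exists>q\<in>{1..Suc ?n}. \<sigma>' q = p \<and> (\<forall>i\<in>{1..<q}. \<sigma>' i < p)"
      proof (cases "p = Suc ?m")
        case True
        have "\<sigma> i < Suc ?m" if "i \<in> {1..<Suc ?n}" for i using range[of i] that by simp
        then show ?thesis using True by (intro bexI[of _ "Suc ?n"]) (simp_all add: \<sigma>'_def)
      next
        case False
        then have "p \<in> {1..?m}" using p by simp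
        then obtain q where "q \<in> {1..?n}" "\<sigma> q = p" "\<forall>i\<in>{1..<q}. \<sigma> i < p"
          using \<sigma>(1) unfolding collapses_def by blast
        then show ?thesis by (intro bexI[of _ q]) (auto simp: \<sigma>'_def)
      qed
    qed
    moreover have "letter (b # ys) i = letter xs (\<sigma>' i)" if "i \<in> {1..Suc ?n}" for i
    proof (cases "i = Suc ?n")
      case True
      then show ?thesis by (simp add: \<sigma>'_def letter_Cons_last xs(1))
    next
      case False
      then have "i \<in> {1..?n}" using that by simp
      then show ?thesis using \<sigma>(2) range[of i] xs(1) by (simp add: \<sigma>'_def letter_Cons)
    qed
    ultimately show ?thesis using xs(1) by (intro exI[of _ \<sigma>']) simp
  qed
qed

text \<open>Higman's lemma for the marked words, after passing to a subsequence with constant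
  \<open>c\<close> and constant letter set.\<close>

lemma tuples_collapse:
  fixes w :: "nat \<Rightarrow> nat \<Rightarrow> 'a" and c :: "nat \<Rightarrow> 'c"
  assumes A: "finite A" and w: "\<And>i. w i \<in> tuples A (n i)" and c: "finite (range c)"
  shows "\<exists>i j. i < j \<and> c i = c j \<and> collapses_to (n j) (w j) (n i) (w i)"
proof -
  \<comment> \<open>The reversal matches \<open>letter\<close>, which counts positions from the
    end.\<close>
  define ws where "ws i = rev (map (w i) [1..<Suc (n i)])" for i
  have len: "length (ws i) = n i" for i by (simp add: ws_def)
  have letter: "letter (ws i) p = w i p" if "p \<in> {1..n i}" for i p
  proof -
    have "letter (ws i) p = map (w i) [1..<Suc (n i)] ! (p - 1)"
      using that by (simp add: letter_def ws_def rev_nth del: upt_Suc)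
    also have "\<dots> = w i ([1..<Suc (n i)] ! (p - 1))"
      using that by (intro nth_map) (auto simp del: upt_Suc)
    also have "\<dots> = w i p" using that by (subst nth_upt) auto
    finally show ?thesis .
  qed
  have ws: "set (ws i) \<subseteq> A" for i using w[of i] by (auto simp: ws_def tuples_def)
  let ?key = "\<lambda>i. (c i, set (ws i))"
  have "finite (range ?key)"
    by (rule finite_subset[of _ "range c \<times> Pow A"]) (use ws c A in auto)
  then obtain i0 where "infinite {i. ?key i = ?key i0}"
    using pigeonhole_infinite[of UNIV ?key] by auto
  then obtain r :: "nat \<Rightarrow> nat" where r: "strict_mono r" "\<And>n. r n \<in> {i. ?key i = ?key i0}"
    using infinite_nat_subsequence by blast
  have "set (mark xs) \<subseteq> set xs \<times> UNIV" for xs :: "'a list" by (induction xs) auto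
  then have range: "range (\<lambda>i. mark (ws (r i))) \<subseteq> lists (A \<times> UNIV)"
    using ws by (fastforce simp: lists_eq_set)
  have "has_chains (lists (A \<times> (UNIV :: bool set)))"
    using A by (intro higman_finite_alphabet) simp
  from has_chainsD[OF this range] obtain \<phi> :: "nat \<Rightarrow> nat" where \<phi>: "strict_mono \<phi>"
    "\<And>i j. i \<le> j \<Longrightarrow> subseq (mark (ws (r (\<phi> i)))) (mark (ws (r (\<phi> j))))"
    by blast
  define i j where "i = r (\<phi> 0)" and "j = r (\<phi> 1)"
  have "i < j" using r(1) \<phi>(1) by (simp add: i_def j_def strict_mono_less)
  have key: "c i = c j" "set (ws i) = set (ws j)"
    using r(2)[of "\<phi> 0"] r(2)[of "\<phi> 1"] by (simp_all add: i_def j_def)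
  have "subseq (mark (ws i)) (mark (ws j))" using \<phi>(2)[of 0 1] by (simp add: i_def j_def)
  from subseq_mark_imp_collapses[OF this key(2)] obtain \<sigma> where \<sigma>: "collapses \<sigma> (n j) (n i)"
    "\<forall>p\<in>{1..n j}. letter (ws j) p = letter (ws i) (\<sigma> p)" by (auto simp: len)
  have "w j p = (\<lambda>p\<in>{1..n j}. w i (\<sigma> p)) p" for p
  proof (cases "p \<in> {1..n j}")
    case True
    moreover have "\<sigma> p \<in> {1..n i}" using \<sigma>(1) True by (auto simp: collapses_def)
    ultimately show ?thesis using \<sigma>(2) letter by simp
  next
    case False
    then show ?thesis
      using PiE_arb[OF w[of j, unfolded tuples_def] False] by (simp only: restrict_apply if_False)
  qed
  then have "w j = (\<lambda>p\<in>{1..n j}. w i (\<sigma> p))" by (rule ext)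
  then have "collapses_to (n j) (w j) (n i) (w i)"
    unfolding collapses_to_def by (intro exI[of _ \<sigma>] conjI \<sigma>(1))
  then show ?thesis using \<open>i < j\<close> key(1) by blast
qed

subsection \<open>Clonoids determined by finitely many members\<close>

definition lex_less :: "('a \<Rightarrow> nat) \<Rightarrow> nat \<Rightarrow> (nat \<Rightarrow> 'a) \<Rightarrow> (nat \<Rightarrow> 'a) \<Rightarrow> bool" where
  "lex_less \<iota> n v w \<longleftrightarrow> (\<exists>p\<in>{1..n}. (\<forall>i\<in>{1..<p}. v i = w i) \<and> \<iota> (v p) < \<iota> (w p))"

lemma lex_less_irrefl: "\<not> lex_less \<iota> n v v"
  by (simp add: lex_less_def)

lemma lex_less_trans:
  assumes "lex_less \<iota> n u v" "lex_less \<iota> n v w"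
  shows "lex_less \<iota> n u w"
proof -
  obtain p where p: "p \<in> {1..n}" "\<forall>i\<in>{1..<p}. u i = v i" "\<iota> (u p) < \<iota> (v p)"
    using assms(1) unfolding lex_less_def by blast
  obtain q where q: "q \<in> {1..n}" "\<forall>i\<in>{1..<q}. v i = w i" "\<iota> (v q) < \<iota> (w q)"
    using assms(2) unfolding lex_less_def by blast
  have "\<iota> (u (min p q)) < \<iota> (w (min p q))"
    using p q by (cases p q rule: linorder_cases) (auto simp: min_def)
  moreover have "min p q \<in> {1..n}" using p(1) q(1) by auto
  moreover have "\<forall>i\<in>{1..<min p q}. u i = w i" using p(2) q(2) by simp
  ultimately show ?thesis unfolding lex_less_def by blast
qed

lemma lex_less_total:
  assumes \<iota>: "inj_on \<iota> A" and vw: "v \<in> tuples A n" "w \<in> tuples A n" "v \<noteq> w"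
  shows "lex_less \<iota> n v w \<or> lex_less \<iota> n w v"
proof -
  define P where "P i \<longleftrightarrow> i \<in> {1..n} \<and> v i \<noteq> w i" for i
  have "\<exists>i. P i"
  proof (rule ccontr)
    assume "\<not> ?thesis"
    then have "v = w" using vw unfolding P_def tuples_def by (intro PiE_ext[of v]) auto
    then show False using vw(3) by simp
  qed
  then have p: "P (LEAST i. P i)" by (rule LeastI_ex)
  define p where "p = (LEAST i. P i)"
  have pn: "p \<in> {1..n}" "v p \<noteq> w p" using p by (simp_all add: p_def P_def)
  have eq: "\<forall>i\<in>{1..<p}. v i = w i"
    using not_less_Least[of _ P] pn(1) unfolding p_def[symmetric] by (auto simp: P_def)
  have "v p \<in> A" "w p \<in> A" using vw pn(1) by (auto simp: tuples_def)
  then have "\<iota> (v p) \<noteq> \<iota> (w p)" using \<iota> pn(2) by (auto simp: inj_on_def)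
  then have "\<iota> (v p) < \<iota> (w p) \<or> \<iota> (w p) < \<iota> (v p)" by linarith
  then show ?thesis unfolding lex_less_def using pn(1) eq by metis
qed

section \<open>Forks of minor-closed sets and their stabilisation\<close>

definition minor_closed :: "'a set \<Rightarrow> ('a, 'b) finitary set \<Rightarrow> bool" where
  "minor_closed A C \<longleftrightarrow> (\<forall>k f l \<sigma>. (k, f) \<in> C \<longrightarrow> 1 \<le> l \<longrightarrow> \<sigma> \<in> {1..k} \<rightarrow> {1..l} \<longrightarrow> (l, minor A k l f \<sigma>) \<in> C)"

definition fork ::
    "'a set \<Rightarrow> ('a \<Rightarrow> nat) \<Rightarrow> ('a, 'b) finitary set \<Rightarrow> nat \<Rightarrow> (nat \<Rightarrow> 'a) \<Rightarrow> 'b \<Rightarrow> 'b \<Rightarrow> bool" where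
  "fork A \<iota> C n w a b \<longleftrightarrow> (\<exists>f g. (n, f) \<in> C \<and> (n, g) \<in> C \<and>
     (\<forall>v\<in>tuples A n. lex_less \<iota> n v w \<longrightarrow> f v = g v) \<and> f w = a \<and> g w = b)"

text \<open>The minors along \<open>\<sigma>\<close> form the new fork. If \<open>v\<close> first
  differs from \<open>w'\<close> at \<open>p\<close>, then the pulled-back tuples first differ at
  the first element of the fibre over \<open>p\<close>, because earlier positions map below
  \<open>p\<close>; so the lexicographic order is preserved.\<close>

lemma fork_minor:
  assumes C: "minor_closed A C" and n': "n' \<ge> 1" and w': "w' \<in> tuples A n'"
    and collapse: "collapses_to n w n' w'"
    and fork: "fork A \<iota> C n w a b"
  shows "fork A \<iota> C n' w' a b"
proof -
  have "\<exists>\<sigma>. collapses \<sigma> n n' \<and> w = (\<lambda>i\<in>{1..n}. w' (\<sigma> i))"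
    using collapse unfolding collapses_to_def .
  then obtain \<sigma> where "collapses \<sigma> n n' \<and> w = (\<lambda>i\<in>{1..n}. w' (\<sigma> i))" ..
  then have \<sigma>: "collapses \<sigma> n n'" and w: "w = (\<lambda>i\<in>{1..n}. w' (\<sigma> i))" by simp_all
  obtain f g where fg: "(n, f) \<in> C" "(n, g) \<in> C" "f w = a" "g w = b"
    and agree: "\<And>v. v \<in> tuples A n \<Longrightarrow> lex_less \<iota> n v w \<Longrightarrow> f v = g v"
    using fork unfolding fork_def by blast
  have \<sigma>n: "\<sigma> \<in> {1..n} \<rightarrow> {1..n'}" using \<sigma> by (simp add: collapses_def)
  let ?f = "minor A n n' f \<sigma>" and ?g = "minor A n n' g \<sigma>"
  have "(n', ?f) \<in> C" "(n', ?g) \<in> C" using C fg n' \<sigma>n unfolding minor_closed_def by blast+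
  moreover have "?f w' = a" "?g w' = b" using w' fg w by (simp_all add: minor_def)
  moreover have "?f v = ?g v" if v: "v \<in> tuples A n'" and less: "lex_less \<iota> n' v w'" for v
  proof -
    let ?v = "\<lambda>i\<in>{1..n}. v (\<sigma> i)"
    obtain p where p: "p \<in> {1..n'}" "\<forall>i\<in>{1..<p}. v i = w' i" "\<iota> (v p) < \<iota> (w' p)"
      using less unfolding lex_less_def by blast
    obtain q where q: "q \<in> {1..n}" "\<sigma> q = p" "\<forall>i\<in>{1..<q}. \<sigma> i < p"
      using \<sigma> p(1) unfolding collapses_def by blast
    have "?v i = w i" if i: "i \<in> {1..<q}" for i
    proof -
      have "i \<in> {1..n}" using i q(1) by simp
      then have "\<sigma> i \<in> {1..<p}" using q(3) i \<sigma>n by (auto simp: Pi_iff)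
      then show ?thesis using p(2) w \<open>i \<in> {1..n}\<close> by simp
    qed
    moreover have "\<iota> (?v q) < \<iota> (w q)" using p(3) q w by simp
    ultimately have "lex_less \<iota> n ?v w" unfolding lex_less_def using q(1) by blast
    moreover have "?v \<in> tuples A n" using v \<sigma>n unfolding tuples_def by fastforce
    ultimately have "f ?v = g ?v" by (rule agree[rotated])
    then show ?thesis using v by (simp add: minor_def)
  qed
  ultimately show ?thesis unfolding fork_def by blast
qed

text \<open>This is \<open>C\<^sup>n\<close> of the overview; it depends only on the members of
  \<open>C\<close> of arity at most \<open>n\<close>.\<close>

definition minor_extension :: "'a set \<Rightarrow> 'b set \<Rightarrow> nat \<Rightarrow> ('a, 'b) finitary set \<Rightarrow> ('a, 'b) finitary set" where
  "minor_extension A B n C = {(k, f). 1 \<le> k \<and> f \<in> tuples A k \<rightarrow>\<^sub>E B \<and>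
     (\<forall>l\<in>{1..n}. \<forall>\<sigma>\<in>{1..k} \<rightarrow> {1..l}. (l, minor A k l f \<sigma>) \<in> C)}"

lemma minor_minor:
  assumes "\<sigma> \<in> {1..k} \<rightarrow> {1..l}" "\<tau> \<in> {1..l} \<rightarrow> {1..m}"
  shows "minor A l m (minor A k l f \<sigma>) \<tau> = minor A k m f (\<lambda>i. \<tau> (\<sigma> i))"
  unfolding minor_def[of A l m] minor_def[of A k m]
proof (rule restrict_ext)
  fix x assume x: "x \<in> tuples A m"
  have "(\<lambda>i\<in>{1..l}. x (\<tau> i)) \<in> tuples A l" using x assms(2) unfolding tuples_def by fastforce
  moreover have "(\<lambda>i\<in>{1..k}. (\<lambda>i\<in>{1..l}. x (\<tau> i)) (\<sigma> i)) = (\<lambda>i\<in>{1..k}. x (\<tau> (\<sigma> i)))"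
    using assms(1) by (intro restrict_ext) (simp add: Pi_iff)
  ultimately show "minor A k l f \<sigma> (\<lambda>i\<in>{1..l}. x (\<tau> i)) = f (\<lambda>i\<in>{1..k}. x (\<tau> (\<sigma> i)))"
    by (simp add: minor_def)
qed

lemma minor_closed_extension: "minor_closed A (minor_extension A B n C)"
  unfolding minor_closed_def
proof (intro allI impI)
  fix k l :: nat and f \<sigma>
  assume kf: "(k, f) \<in> minor_extension A B n C" and l: "1 \<le> l" "\<sigma> \<in> {1..k} \<rightarrow> {1..l}"
  have f: "f \<in> tuples A k \<rightarrow>\<^sub>E B"
    and min: "\<And>m \<tau>. m \<in> {1..n} \<Longrightarrow> \<tau> \<in> {1..k} \<rightarrow> {1..m} \<Longrightarrow> (m, minor A k m f \<tau>) \<in> C"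
    using kf unfolding minor_extension_def by auto
  have "(m, minor A l m (minor A k l f \<sigma>) \<tau>) \<in> C" if "m \<in> {1..n}" "\<tau> \<in> {1..l} \<rightarrow> {1..m}" for m \<tau>
    unfolding minor_minor[OF l(2) that(2)] by (rule min[OF that(1)]) (use l(2) that(2) in fast)
  then show "(l, minor A k l f \<sigma>) \<in> minor_extension A B n C"
    unfolding minor_extension_def using l(1) minor_PiE[OF f l(2)] by blast
qed

lemma clonoid_minor_closed: "clonoid A B F C \<Longrightarrow> minor_closed A C"
  unfolding clonoid_def minor_closed_def by blast

lemma clonoid_subset_extension:
  assumes "clonoid A B F C" shows "C \<subseteq> minor_extension A B n C"
proof
  fix kf assume kf: "kf \<in> C"
  obtain k f where eq: "kf = (k, f)" by force
  have "1 \<le> k" "f \<in> tuples A k \<rightarrow>\<^sub>E B" using assms kf unfolding clonoid_def eq by blast+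
  moreover have "(l, minor A k l f \<sigma>) \<in> C" if "l \<in> {1..n}" "\<sigma> \<in> {1..k} \<rightarrow> {1..l}" for l \<sigma>
    using clonoid_minor_closed[OF assms] kf that unfolding minor_closed_def eq by simp
  ultimately show "kf \<in> minor_extension A B n C" unfolding minor_extension_def eq by blast
qed

lemma extension_low_arity:
  assumes "(k, f) \<in> minor_extension A B n C" "k \<le> n"
  shows "(k, f) \<in> C"
proof -
  have k: "k \<in> {1..n}" and f: "f \<in> tuples A k \<rightarrow>\<^sub>E B" and "(k, minor A k k f id) \<in> C"
    using assms unfolding minor_extension_def by auto
  moreover have "minor A k k f id = f"
  proof
    fix x
    show "minor A k k f id x = f x"
    proof (cases "x \<in> tuples A k")
      case True
      then have "(\<lambda>i\<in>{1..k}. x i) = x" unfolding tuples_def by (rule PiE_restrict)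
      then show ?thesis using True by (simp add: minor_def)
    next
      case False
      then show ?thesis using PiE_arb[OF f] by (simp add: minor_def)
    qed
  qed
  ultimately show ?thesis by simp
qed

lemma extension_antimono: "n \<le> n' \<Longrightarrow> minor_extension A B n' C \<subseteq> minor_extension A B n C"
  unfolding minor_extension_def by fastforce

lemma fork_mono: "fork A \<iota> C n w a b \<Longrightarrow> C \<subseteq> C' \<Longrightarrow> fork A \<iota> C' n w a b"
  unfolding fork_def by blast

text \<open>Otherwise pick elements that leave the sequence at successive stages. If an earlier one
  were below a later one, it would still belong to the down-set it has left.\<close>

lemma decreasing_downsets_stabilize:
  fixes \<Phi> :: "nat \<Rightarrow> 'x set"
  assumes good: "\<And>x :: nat \<Rightarrow> 'x. range x \<subseteq> D \<Longrightarrow> \<exists>i j. i < j \<and> le (x i) (x j)"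
    and D: "\<And>n. \<Phi> n \<subseteq> D" and anti: "\<And>m n. m \<le> n \<Longrightarrow> \<Phi> n \<subseteq> \<Phi> m"
    and down: "\<And>n x y. y \<in> \<Phi> n \<Longrightarrow> x \<in> D \<Longrightarrow> le x y \<Longrightarrow> x \<in> \<Phi> n"
  shows "\<exists>N. \<forall>n\<ge>N. \<Phi> n = \<Phi> N"
proof (rule ccontr)
  assume "\<not> ?thesis"
  then have "\<forall>N. \<exists>n x. N \<le> n \<and> x \<in> \<Phi> N \<and> x \<notin> \<Phi> n" using anti by blast
  then obtain s el where s: "\<And>N. N \<le> s N" "\<And>N. el N \<in> \<Phi> N" "\<And>N. el N \<notin> \<Phi> (s N)" by metis
  define \<nu> where "\<nu> i = (s ^^ i) 0" for i
  have \<nu>: "\<nu> (Suc i) = s (\<nu> i)" for i by (simp add: \<nu>_def)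
  have mono: "i \<le> j \<Longrightarrow> \<nu> i \<le> \<nu> j" for i j
    by (rule lift_Suc_mono_le[of \<nu>]) (simp_all add: \<nu> s(1))
  have "range (\<lambda>i. el (\<nu> i)) \<subseteq> D" using s(2) D by blast
  from good[OF this] obtain i j where ij: "i < j" "le (el (\<nu> i)) (el (\<nu> j))" by blast
  have "\<nu> (Suc i) \<le> \<nu> j" using ij(1) by (intro mono) simp
  then have "el (\<nu> j) \<in> \<Phi> (\<nu> (Suc i))" using s(2)[of "\<nu> j"] anti by blast
  then have "el (\<nu> i) \<in> \<Phi> (\<nu> (Suc i))" using down[OF _ _ ij(2)] s(2)[of "\<nu> i"] D by blast
  then show False using s(3)[of "\<nu> i"] by (simp add: \<nu>)
qed

lemma forks_stabilize:
  assumes A: "finite A" and B: "finite B"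
  shows "\<exists>N. \<forall>n\<ge>N. \<forall>k\<ge>1. \<forall>w\<in>tuples A k. \<forall>a\<in>B. \<forall>b\<in>B.
    fork A \<iota> (minor_extension A B N C) k w a b \<longrightarrow> fork A \<iota> (minor_extension A B n C) k w a b"
proof -
  define D where "D = {(k, w, a, b). k \<ge> 1 \<and> w \<in> tuples A k \<and> a \<in> B \<and> b \<in> B}"
  define \<Phi> where "\<Phi> n = {(k, w, a, b) \<in> D. fork A \<iota> (minor_extension A B n C) k w a b}" for n
  \<comment> \<open>The smaller fork has the tuple \<open>w'\<close> from which \<open>w\<close> is
    pulled back; by \<open>fork_minor\<close>, forks pass down along this relation.\<close>
  define le where "le = (\<lambda>(k', w' :: nat \<Rightarrow> 'a, a', b') (k, w :: nat \<Rightarrow> 'a, a :: 'b, b :: 'b).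
    a' = a \<and> b' = b \<and> collapses_to k w k' w')"
  have "\<exists>N. \<forall>n\<ge>N. \<Phi> n = \<Phi> N"
  proof (rule decreasing_downsets_stabilize[where D = D and le = le])
    fix x :: "nat \<Rightarrow> nat \<times> (nat \<Rightarrow> 'a) \<times> 'b \<times> 'b"
    assume x: "range x \<subseteq> D"
    define n w c where "n i = fst (x i)" and "w i = fst (snd (x i))" and "c i = snd (snd (x i))" for i
    have "x i \<in> D" for i using x by blast
    then have wc: "w i \<in> tuples A (n i)" "c i \<in> B \<times> B" for i
      by (simp_all add: D_def n_def w_def c_def mem_Times_iff case_prod_beta)
    have "range c \<subseteq> B \<times> B" using wc(2) by blast
    then have "finite (range c)" using B by (meson finite_SigmaI finite_subset)
    have "\<exists>i j. i < j \<and> c i = c j \<and> collapses_to (n j) (w j) (n i) (w i)"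
      by (rule tuples_collapse[where w = w and n = n and c = c]) fact+
    moreover have "le (x i) (x j) \<longleftrightarrow> c i = c j \<and> collapses_to (n j) (w j) (n i) (w i)" for i j
      by (simp add: le_def n_def w_def c_def case_prod_beta prod_eq_iff)
    ultimately show "\<exists>i j. i < j \<and> le (x i) (x j)" by (simp only:)
  next
    show "\<Phi> n \<subseteq> D" for n by (auto simp: \<Phi>_def)
    show "\<Phi> n \<subseteq> \<Phi> m" if "m \<le> n" for m n
      using fork_mono[OF _ extension_antimono[OF that]] by (auto simp: \<Phi>_def)
    fix n x y assume y: "y \<in> \<Phi> n" and x: "x \<in> D" and le: "le x y"
    obtain k w a b where y_eq: "y = (k, w, a, b)" by (cases y)
    obtain k' w' a' b' where x_eq: "x = (k', w', a', b')" by (cases x)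
    have ab: "a' = a" "b' = b" and collapse: "collapses_to k w k' w'"
      using le unfolding le_def x_eq y_eq by auto
    have fork: "fork A \<iota> (minor_extension A B n C) k w a b" using y unfolding \<Phi>_def y_eq by blast
    have k': "k' \<ge> 1" "w' \<in> tuples A k'" using x unfolding D_def x_eq by blast+
    have "fork A \<iota> (minor_extension A B n C) k' w' a b"
      by (rule fork_minor[OF minor_closed_extension k' collapse fork])
    then show "x \<in> \<Phi> n" using x ab unfolding \<Phi>_def x_eq by blast
  qed
  then obtain N where N: "\<forall>n\<ge>N. \<Phi> n = \<Phi> N" ..
  show ?thesis
  proof (intro exI[of _ N] allI impI ballI)
    fix n k w a b
    assume *: "N \<le> n" "1 \<le> k" "w \<in> tuples A k" "a \<in> B" "b \<in> B"
      "fork A \<iota> (minor_extension A B N C) k w a b"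
    then have "(k, w, a, b) \<in> \<Phi> N" unfolding \<Phi>_def D_def by blast
    then have "(k, w, a, b) \<in> \<Phi> n" using N *(1) by blast
    then show "fork A \<iota> (minor_extension A B n C) k w a b" unfolding \<Phi>_def by blast
  qed
qed

text \<open>
  Identifying the arguments that \<open>J\<close> does not distinguish leaves at most \<open>card A ^ card J\<close>
  of them.
\<close>
lemma extension_agrees_on_small:
  assumes C: "minor_closed A C" and A: "finite A" and s: "(k, s) \<in> minor_extension A B n C"
    and J: "J \<subseteq> tuples A k" "card A ^ card J \<le> n"
  shows "\<exists>r. (k, r) \<in> C \<and> (\<forall>x\<in>J. r x = s x)"
proof -
  have k: "k \<ge> 1" using s by (simp add: minor_extension_def)
  have "finite J" using J(1) finite_tuples[OF A] finite_subset by blast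
  \<comment> \<open>With \<open>J\<close> read as a matrix whose rows are its tuples, this is column
    \<open>i\<close>; \<open>\<sigma>\<close> numbers the distinct columns and \<open>\<tau>\<close>
    picks a representative of each.\<close>
  define col where "col i = (\<lambda>x\<in>J. x i)" for i
  define Q where "Q = col ` {1..k}"
  define q where "q = card Q"
  have "x i \<in> A" if "x \<in> J" "i \<in> {1..k}" for x i
    using J(1) that unfolding tuples_def by blast
  then have "Q \<subseteq> J \<rightarrow>\<^sub>E A" unfolding Q_def col_def by (intro image_subsetI) simp
  then have "card Q \<le> card (J \<rightarrow>\<^sub>E A)" using A \<open>finite J\<close> by (intro card_mono finite_PiE)
  also have "\<dots> = card A ^ card J" using \<open>finite J\<close> by (simp add: card_PiE)
  finally have "q \<le> n" using J(2) by (simp add: q_def)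
  have "finite Q" "Q \<noteq> {}" using k by (auto simp: Q_def)
  then have "q \<ge> 1" by (simp add: q_def Suc_le_eq card_gt_0_iff)
  have "\<exists>h. bij_betw h Q {1..q}"
    using \<open>finite Q\<close> by (intro finite_same_card_bij) (simp_all add: q_def)
  then obtain h where h: "bij_betw h Q {1..q}" ..
  define \<sigma> where "\<sigma> i = h (col i)" for i
  define \<tau> where "\<tau> = inv_into {1..k} \<sigma>"
  have im: "\<sigma> ` {1..k} = {1..q}"
    using bij_betw_imp_surj_on[OF h] unfolding Q_def \<sigma>_def image_image .
  have \<sigma>: "\<sigma> \<in> {1..k} \<rightarrow> {1..q}" using im by blast
  have \<tau>: "\<tau> \<in> {1..q} \<rightarrow> {1..k}" unfolding \<tau>_def using inv_into_into[of _ \<sigma> "{1..k}"] im by blast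
  have \<tau>\<sigma>: "x (\<tau> (\<sigma> i)) = x i" if "x \<in> J" "i \<in> {1..k}" for x i
  proof -
    have i: "\<tau> (\<sigma> i) \<in> {1..k}" using \<sigma> \<tau> that(2) by blast
    have "\<sigma> (\<tau> (\<sigma> i)) = \<sigma> i" unfolding \<tau>_def using that(2) by (intro f_inv_into_f) blast
    then have "col (\<tau> (\<sigma> i)) = col i"
      using inj_onD[OF bij_betw_imp_inj_on[OF h]] i that(2) unfolding \<sigma>_def Q_def by blast
    from fun_cong[OF this, of x] show ?thesis using that(1) by (simp add: col_def)
  qed
  have "(q, minor A k q s \<sigma>) \<in> C"
    using s \<sigma> \<open>q \<le> n\<close> \<open>q \<ge> 1\<close> by (simp add: minor_extension_def)
  then have "(k, minor A q k (minor A k q s \<sigma>) \<tau>) \<in> C"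
    using C k \<tau> unfolding minor_closed_def by blast
  moreover have "minor A q k (minor A k q s \<sigma>) \<tau> x = s x" if x: "x \<in> J" for x
  proof -
    have xt: "x \<in> tuples A k" using x J(1) by blast
    have "(\<lambda>i\<in>{1..k}. x (\<tau> (\<sigma> i))) = (\<lambda>i\<in>{1..k}. x i)"
      by (rule restrict_ext) (rule \<tau>\<sigma>[OF x])
    also have "\<dots> = x" using xt unfolding tuples_def by (rule PiE_restrict)
    finally show ?thesis unfolding minor_minor[OF \<sigma> \<tau>] using xt by (simp add: minor_def)
  qed
  ultimately show ?thesis by blast
qed

text \<open>\<open>subpower_eqI\<close> compares the \<open>k\<close>-ary parts of \<open>C\<close>
  and its extension; one \<open>n\<close> works for all arities \<open>k\<close>.\<close>

lemma clonoid_eq_extension: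
  assumes A: "finite A" "card A > 1" and B: "finite B" "algebra B F" "idempotent B F"
    and cube: "has_cube_term B F" and C: "clonoid A B F C"
  shows "\<exists>n. C = minor_extension A B n C"
proof -
  obtain d e where de: "d \<ge> 3" "family_op B F (edge_family 2 d) e"
    using family_op_edge[OF B(2,3) cube] by blast
  interpret edge_op B F d e by unfold_locales (use B de in auto)
  obtain \<iota> :: "'a \<Rightarrow> nat" where \<iota>: "inj_on \<iota> A" using finite_imp_inj_to_nat_seg[OF A(1)] by blast
  let ?E = "\<lambda>n. minor_extension A B n C"
  obtain N where N: "\<forall>n\<ge>N. \<forall>k\<ge>1. \<forall>w\<in>tuples A k. \<forall>a\<in>B. \<forall>b\<in>B.
      fork A \<iota> (?E N) k w a b \<longrightarrow> fork A \<iota> (?E n) k w a b"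
    using forks_stabilize[OF A(1) B(1)] by blast
  \<comment> \<open>\<open>N\<close> is where the forks stabilise; the power of
    \<open>card A\<close> handles projections to \<open>2 * d\<close> coordinates.\<close>
  define n where "n = max N (card A ^ (2 * d))"
  have "(k, f) \<in> C" if kf: "(k, f) \<in> ?E n" for k f
  proof -
    have k: "k \<ge> 1" using kf by (simp add: minor_extension_def)
    have "{f. (k, f) \<in> ?E n} = {f. (k, f) \<in> C}"
    proof (rule subpower_eqI[where X = "tuples A k" and lt = "lex_less \<iota> k"])
      show "subalgebra_of_power (tuples A k) B F {f. (k, f) \<in> C}"
        using C k unfolding clonoid_def by blast
      show "{f. (k, f) \<in> ?E n} \<subseteq> tuples A k \<rightarrow>\<^sub>E B" by (auto simp: minor_extension_def)
      show "{f. (k, f) \<in> C} \<subseteq> {f. (k, f) \<in> ?E n}" using clonoid_subset_extension[OF C] by blast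
      show "finite (tuples A k)" by (rule finite_tuples[OF A(1)])
      show "\<not> lex_less \<iota> k x x" for x by (rule lex_less_irrefl)
      show "lex_less \<iota> k x z" if "lex_less \<iota> k x y" "lex_less \<iota> k y z" for x y z
        using that by (rule lex_less_trans)
      show "lex_less \<iota> k x y \<or> lex_less \<iota> k y x"
        if "x \<in> tuples A k" "y \<in> tuples A k" "x \<noteq> y" for x y
        using \<iota> that by (rule lex_less_total)
    next
      fix s J assume s: "s \<in> {f. (k, f) \<in> ?E n}" and J: "J \<subseteq> tuples A k" "card J \<le> 2 * d"
      have "card A ^ card J \<le> card A ^ (2 * d)" using A(2) J(2) by (intro power_increasing) simp_all
      then have "card A ^ card J \<le> n" by (simp add: n_def)
      then show "\<exists>r\<in>{f. (k, f) \<in> C}. \<forall>x\<in>J. r x = s x"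
        using extension_agrees_on_small[OF clonoid_minor_closed[OF C] A(1) _ J(1)] s by blast
    next
      fix m f g
      assume m: "m \<in> tuples A k" and f: "f \<in> {f. (k, f) \<in> ?E n}" and g: "g \<in> {f. (k, f) \<in> ?E n}"
        and agree: "\<And>x. x \<in> tuples A k \<Longrightarrow> lex_less \<iota> k x m \<Longrightarrow> f x = g x"
      have fm: "f m \<in> B" "g m \<in> B" using f g m by (auto simp: minor_extension_def)
      have "fork A \<iota> (?E n) k m (f m) (g m)" unfolding fork_def using f g agree by blast
      then have "fork A \<iota> (?E N) k m (f m) (g m)"
        by (rule fork_mono) (rule extension_antimono, simp add: n_def)
      \<comment> \<open>At level \<open>max n k\<close> all \<open>k\<close>-ary members of the
        extension already lie in \<open>C\<close>, so the fork is witnessed in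
        \<open>C\<close>.\<close>
      then have "fork A \<iota> (?E (max n k)) k m (f m) (g m)"
        using N k m fm by (simp add: n_def)
      then obtain u v where uv: "(k, u) \<in> ?E (max n k)" "(k, v) \<in> ?E (max n k)"
        "\<forall>x\<in>tuples A k. lex_less \<iota> k x m \<longrightarrow> u x = v x" "u m = f m" "v m = g m"
        unfolding fork_def by blast
      then have "(k, u) \<in> C" "(k, v) \<in> C" using extension_low_arity by fastforce+
      then show "\<exists>u\<in>{f. (k, f) \<in> C}. \<exists>v\<in>{f. (k, f) \<in> C}.
          (\<forall>x\<in>tuples A k. lex_less \<iota> k x m \<longrightarrow> u x = v x) \<and> u m = f m \<and> v m = g m"
        using uv(3-5) by blast
    qed
    then show ?thesis using kf by blast
  qed
  then have "?E n \<subseteq> C" by auto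
  then show ?thesis using clonoid_subset_extension[OF C] by blast
qed

text \<open>A clonoid is recovered from some \<open>n\<close> and its trace on the finite set
  \<open>L n\<close>, so there are only countably many.\<close>

lemma countable_clonoids:
  assumes A: "finite A" "card A > 1" and B: "finite B" "algebra B F" "idempotent B F"
    and cube: "has_cube_term B F"
  shows "countable (clonoids A B F)"
proof -
  define L where "L n = (SIGMA l:{1..n}. tuples A l \<rightarrow>\<^sub>E B)" for n :: nat
  have "finite (L n)" for n
    unfolding L_def using A(1) B(1) by (intro finite_SigmaI finite_PiE finite_tuples) simp_all
  then have "countable (\<Union>n. minor_extension A B n ` Pow (L n))"
    by (intro countable_UN) (auto intro: countable_finite)
  moreover have "clonoids A B F \<subseteq> (\<Union>n. minor_extension A B n ` Pow (L n))"
  proof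
    fix C assume "C \<in> clonoids A B F"
    then have C: "clonoid A B F C" by (simp add: clonoids_def)
    obtain n where n: "C = minor_extension A B n C" using clonoid_eq_extension[OF assms C] by blast
    have "(l, f) \<in> C \<longleftrightarrow> (l, f) \<in> C \<inter> L n" if "l \<in> {1..n}" for l f
      using C that unfolding clonoid_def L_def by blast
    then have "minor_extension A B n C = minor_extension A B n (C \<inter> L n)"
      unfolding minor_extension_def by blast
    then have "C = minor_extension A B n (C \<inter> L n)" using n by simp
    then show "C \<in> (\<Union>n. minor_extension A B n ` Pow (L n))" by blast
  qed
  ultimately show ?thesis by (rule countable_subset[rotated])
qed

theorem theorem1p4:
  fixes A :: "'a set" and B :: "'b set" and F :: "('b, 'b) finitary set"
  assumes "finite A" and "finite B"
    and "algebra B F" and "idempotent B F"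
    and "card A > 1" and "card B > 1"
  shows "clonoids A B F \<approx> (UNIV :: real set) \<longleftrightarrow> \<not> has_cube_term B F"
proof
  assume eq: "clonoids A B F \<approx> (UNIV :: real set)"
  show "\<not> has_cube_term B F"
  proof
    assume "has_cube_term B F"
    then have "countable (clonoids A B F)" using assms by (intro countable_clonoids)
    then have "countable (UNIV :: real set)" using eq countable_lepoll eqpoll_imp_lepoll eqpoll_sym by metis
    then show False using uncountable_UNIV_real by blast
  qed
qed (rule clonoids_eqpoll_reals[OF assms(1-5)])

end
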